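(* Let $M$ be a hypersurface in a semi-Riemannian space of constant curvature $N_{s}^{n+1}(c)$, $n \geq 3$, whose second fundamental tensor $H$ satisfies $H^{3} = \phi H^{2} + \psi H + \rho g$ on $\mathcal{U}_{H}\subset M$, where $\phi,\psi,\rho$ are some functions on $\mathcal{U}_H$. Let $$\tau=\rho + (\phi - \mathrm{tr}(H))\bigl(\psi + \mathrm{tr}(H)(\phi - \mathrm{tr}(H))\bigr),\qquad \rho_1=2(n-1)c-\varepsilon(\psi+(\phi-\mathrm{tr}(H))^2),$$ $$\rho_0=-(n-1)^2c^2+\varepsilon(\psi+(\phi-\mathrm{tr}(H))^2)(n-1)c+\rho(\phi-2\,\mathrm{tr}(H))$$ on $\mathcal{U}_H$. If $M$ is partially Einstein at every point of $\mathcal{U}_{H}$, then $S^{2} = \rho_{1} S + \rho_{0} g$ and $\tau = 0$, i.e. $$\rho + (\phi - \mathrm{tr}(H))\bigl(\psi + \mathrm{tr}(H)(\phi - \mathrm{tr}(H))\bigr) = 0,$$ on $\mathcal{U}_{H}$.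
   Context: All manifolds are connected, paracompact and of class $C^\infty$. $N_s^{n+1}(c)$ is a semi-Riemannian space of constant curvature with signature $(s,n+1-s)$, $c=\widetilde\kappa/(n(n+1))$, where $\widetilde\kappa$ is its scalar curvature. $M$ is a hypersurface isometrically immersed in it, with induced (semi-Riemannian) metric $g$, shape operator $\mathcal{A}$ and second fundamental tensor $H(X,Y)=g(\mathcal{A}X,Y)$. Curvature conventions: $\mathcal{R}(X,Y)Z=\nabla_X\nabla_YZ-\nabla_Y\nabla_XZ-\nabla_{[X,Y]}Z$, $R(X_1,X_2,X_3,X_4)=g(\mathcal{R}(X_1,X_2)X_3,X_4)$, and $S(X,Y)=\mathrm{tr}\{Z\mapsto\mathcal{R}(Z,X)Y\}$ is the Ricci tensor of $M$. For a symmetric $(0,2)$-tensor $T$ with associated operator $\mathcal{T}$, $g(\mathcal{T}X,Y)=T(X,Y)$, put $T^1=T$, $T^{p}(X,Y)=T^{p-1}(\mathcal{T}X,Y)$ and $\mathrm{tr}(T)=\mathrm{tr}\,\mathcal{T}$. The Gauss equation of $M$ in local components reads $R_{hijk}=\varepsilon(H_{hk}H_{ij}-H_{hj}H_{ik})+c(g_{hk}g_{ij}-g_{hj}g_{ik})$, where $\varepsilon=\pm1$. $\mathcal{U}_H$ is the set of all points of $M$ at which $H^2$ is not a linear combination of $H$ and $g$. $M$ is partially Einstein at a point if $S^2$ is a linear combination of $S$ and $g$ at that point. *)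

theory Defs
  imports "HOL-Analysis.Analysis"
begin

section \<open>Smooth functions on open subsets of Euclidean space\<close>

definition partial_deriv :: "'n::finite \<Rightarrow> (real^'n \<Rightarrow> real) \<Rightarrow> real^'n \<Rightarrow> real" where
  "partial_deriv i F x = frechet_derivative F (at x) (axis i 1)"

(* Only used for open S, where the values of F outside S are irrelevant. *)
primrec Ck_on :: "nat \<Rightarrow> (real^'n::finite) set \<Rightarrow> (real^'n \<Rightarrow> real) \<Rightarrow> bool" where
  "Ck_on 0 S F \<longleftrightarrow> continuous_on S F"
| "Ck_on (Suc k) S F \<longleftrightarrow>
     (\<forall>x\<in>S. F differentiable (at x)) \<and> (\<forall>i. Ck_on k S (partial_deriv i F))"

definition smooth_fun_on :: "(real^'n::finite) set \<Rightarrow> (real^'n \<Rightarrow> real) \<Rightarrow> bool" where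
  "smooth_fun_on S F \<longleftrightarrow> (\<forall>k. Ck_on k S F)"


section \<open>Charts and manifolds\<close>

(* A chart is a pair (U, x) of a domain and a coordinate map; x is only meaningful on U.
   The dimension of the manifold is the cardinality of the index type 'n. *)
type_synonym ('a, 'n) chart = "'a set \<times> ('a \<Rightarrow> real^'n)"

definition chart_image :: "('a, 'n::finite) chart \<Rightarrow> 'a set \<Rightarrow> (real^'n) set" where
  "chart_image u W = snd u ` (fst u \<inter> W)"

definition coord_rep :: "('a, 'n::finite) chart \<Rightarrow> ('a \<Rightarrow> 'c) \<Rightarrow> real^'n \<Rightarrow> 'c" where
  "coord_rep u F = F \<circ> inv_into (fst u) (snd u)"

(* (chart_pd u i F) p is the derivative at p of F along the i-th coordinate field of u. *)
definition chart_pd ::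
  "('a, 'n::finite) chart \<Rightarrow> 'n \<Rightarrow> ('a \<Rightarrow> real) \<Rightarrow> 'a \<Rightarrow> real" where
  "chart_pd u i F p = partial_deriv i (coord_rep u F) (snd u p)"

definition is_chart :: "'a topology \<Rightarrow> ('a, 'n::finite) chart \<Rightarrow> bool" where
  "is_chart X u \<longleftrightarrow>
     openin X (fst u) \<and> open (snd u ` fst u) \<and>
     homeomorphic_map (subtopology X (fst u)) (top_of_set (snd u ` fst u)) (snd u)"

definition compatible_charts :: "('a, 'n::finite) chart \<Rightarrow> ('a, 'n) chart \<Rightarrow> bool" where
  "compatible_charts u v \<longleftrightarrow>
     (\<forall>a. smooth_fun_on (chart_image u (fst v)) (coord_rep u (\<lambda>q. snd v q $ a)))"

definition smooth_atlas :: "'a topology \<Rightarrow> ('a, 'n::finite) chart set \<Rightarrow> bool" where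
  "smooth_atlas X A \<longleftrightarrow>
     (\<forall>u\<in>A. is_chart X u) \<and> (\<Union>u\<in>A. fst u) = topspace X \<and>
     (\<forall>u\<in>A. \<forall>v\<in>A. compatible_charts u v)"

definition paracompact_space :: "'a topology \<Rightarrow> bool" where
  "paracompact_space X \<longleftrightarrow>
     (\<forall>\<U>. (\<forall>U\<in>\<U>. openin X U) \<and> \<Union>\<U> = topspace X \<longrightarrow>
        (\<exists>\<V>. (\<forall>V\<in>\<V>. openin X V \<and> (\<exists>U\<in>\<U>. V \<subseteq> U)) \<and> \<Union>\<V> = topspace X \<and>
             locally_finite_in X \<V>))"

definition smooth_manifold :: "'a topology \<Rightarrow> ('a, 'n::finite) chart set \<Rightarrow> bool" where
  "smooth_manifold X A \<longleftrightarrow>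
     Hausdorff_space X \<and> connected_space X \<and> paracompact_space X \<and> smooth_atlas X A"


section \<open>Tensor fields and semi-Riemannian metrics\<close>

(* A (0,2)-tensor field T is given by its matrix T u p of components T(d_i, d_j) in every
   chart u of the atlas around p, subject to the tensorial transformation law below. *)
type_synonym ('a, 'n) tensor2 = "('a, 'n) chart \<Rightarrow> 'a \<Rightarrow> real^'n^'n"

record ('a, 'n) semi_riem =
  topo :: "'a topology"
  atlas :: "('a, 'n) chart set"
  metric :: "('a, 'n) tensor2"

definition charts_at :: "('a, 'n::finite) semi_riem \<Rightarrow> 'a \<Rightarrow> ('a, 'n) chart set" where
  "charts_at M p = {u \<in> atlas M. p \<in> fst u}"

definition transition :: "('a, 'n::finite) chart \<Rightarrow> ('a, 'n) chart \<Rightarrow> 'a \<Rightarrow> real^'n^'n" where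
  "transition u v p = (\<chi> a b. chart_pd u b (\<lambda>q. snd v q $ a) p)"

definition tensor_field :: "('a, 'n::finite) semi_riem \<Rightarrow> ('a, 'n) tensor2 \<Rightarrow> bool" where
  "tensor_field M T \<longleftrightarrow>
     (\<forall>p\<in>topspace (topo M). \<forall>u\<in>charts_at M p. \<forall>v\<in>charts_at M p.
        T u p = transpose (transition u v p) ** T v p ** transition u v p)"

definition smooth_tensor_field :: "('a, 'n::finite) semi_riem \<Rightarrow> ('a, 'n) tensor2 \<Rightarrow> bool" where
  "smooth_tensor_field M T \<longleftrightarrow>
     tensor_field M T \<and>
     (\<forall>u\<in>atlas M. \<forall>i j. smooth_fun_on (snd u ` fst u) (coord_rep u (\<lambda>q. T u q $ i $ j)))"

(* The symmetric bilinear form with matrix G has signature (s, n - s): there is an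
   orthonormal basis (the columns of P), exactly s of whose vectors have square -1. *)
definition has_signature :: "real^'n^'n::finite \<Rightarrow> nat \<Rightarrow> bool" where
  "has_signature G s \<longleftrightarrow>
     (\<exists>(P :: real^'n^'n) \<sigma>. invertible P \<and> (\<forall>i. \<sigma> i = 1 \<or> \<sigma> i = -1) \<and> card {i. \<sigma> i = -1} = s \<and>
        transpose P ** G ** P = (\<chi> i j. if i = j then \<sigma> i else 0))"

definition has_index :: "('a, 'n::finite) semi_riem \<Rightarrow> nat \<Rightarrow> bool" where
  "has_index M s \<longleftrightarrow>
     (\<forall>p\<in>topspace (topo M). \<forall>u\<in>charts_at M p. has_signature (metric M u p) s)"

definition semi_riemannian :: "('a, 'n::finite) semi_riem \<Rightarrow> bool" where
  "semi_riemannian M \<longleftrightarrow>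
     smooth_manifold (topo M) (atlas M) \<and> smooth_tensor_field M (metric M) \<and>
     (\<forall>p\<in>topspace (topo M). \<forall>u\<in>charts_at M p.
        transpose (metric M u p) = metric M u p \<and> invertible (metric M u p)) \<and>
     (\<exists>s. has_index M s)"


section \<open>Levi-Civita connection and curvature\<close>

(* christoffel M u p k i j is the k-th component of \<nabla>_{d_i} d_j. *)
definition christoffel ::
  "('a, 'n::finite) semi_riem \<Rightarrow> ('a, 'n) chart \<Rightarrow> 'a \<Rightarrow> 'n \<Rightarrow> 'n \<Rightarrow> 'n \<Rightarrow> real" where
  "christoffel M u p k i j =
     (1/2) * (\<Sum>l\<in>UNIV. matrix_inv (metric M u p) $ k $ l *
        (chart_pd u i (\<lambda>q. metric M u q $ j $ l) p + chart_pd u j (\<lambda>q. metric M u q $ i $ l) p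
         - chart_pd u l (\<lambda>q. metric M u q $ i $ j) p))"

(* curvature_op M u p i j k l is the l-th component of \<R>(d_i, d_j) d_k, where
   \<R>(X,Y)Z = \<nabla>_X \<nabla>_Y Z - \<nabla>_Y \<nabla>_X Z - \<nabla>_[X,Y] Z. *)
definition curvature_op ::
  "('a, 'n::finite) semi_riem \<Rightarrow> ('a, 'n) chart \<Rightarrow> 'a \<Rightarrow> 'n \<Rightarrow> 'n \<Rightarrow> 'n \<Rightarrow> 'n \<Rightarrow> real" where
  "curvature_op M u p i j k l =
     chart_pd u i (\<lambda>q. christoffel M u q l j k) p - chart_pd u j (\<lambda>q. christoffel M u q l i k) p
     + (\<Sum>m\<in>UNIV. christoffel M u p m j k * christoffel M u p l i m
                - christoffel M u p m i k * christoffel M u p l j m)"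

(* R(d_h, d_i, d_j, d_k) = g(\<R>(d_h, d_i) d_j, d_k). *)
definition riemann ::
  "('a, 'n::finite) semi_riem \<Rightarrow> ('a, 'n) chart \<Rightarrow> 'a \<Rightarrow> 'n \<Rightarrow> 'n \<Rightarrow> 'n \<Rightarrow> 'n \<Rightarrow> real" where
  "riemann M u p h i j k = (\<Sum>l\<in>UNIV. curvature_op M u p h i j l * metric M u p $ l $ k)"

(* S(X,Y) = tr (Z \<mapsto> \<R>(Z,X)Y). *)
definition ricci :: "('a, 'n::finite) semi_riem \<Rightarrow> ('a, 'n) tensor2" where
  "ricci M = (\<lambda>u p. \<chi> i j. \<Sum>h\<in>UNIV. curvature_op M u p h i j h)"


section \<open>Algebra of (0,2)-tensors at a point\<close>

(* For symmetric T, the matrix of the operator \<T> with g(\<T> X, Y) = T(X,Y), G being that of g. *)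
definition assoc_operator :: "real^'n^'n::finite \<Rightarrow> real^'n^'n \<Rightarrow> real^'n^'n" where
  "assoc_operator G T = matrix_inv G ** T"

lemma assoc_operator_characterisation:
  assumes "invertible G" "transpose G = G" "transpose T = T"
  shows "(assoc_operator G T *v X) \<bullet> (G *v Y) = X \<bullet> (T *v Y)"
proof -
  have "(assoc_operator G T *v X) \<bullet> (G *v Y) = (G *v (assoc_operator G T *v X)) \<bullet> Y"
    using assms(2) by (metis dot_lmul_matrix transpose_matrix_vector)
  also have "G *v (assoc_operator G T *v X) = T *v X"
  proof -
    have "G ** matrix_inv G = mat 1"
      using assms(1) unfolding invertible_def matrix_inv_def by (metis (mono_tags, lifting) someI_ex)
    then show ?thesis
      by (simp add: assoc_operator_def matrix_vector_mul_assoc matrix_mul_assoc)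
  qed
  also have "(T *v X) \<bullet> Y = X \<bullet> (T *v Y)"
    using assms(3) by (metis dot_lmul_matrix transpose_matrix_vector)
  finally show ?thesis .
qed

(* T^1 = T and T^(p+1)(X,Y) = T^p(\<T> X, Y); the value g for p = 0 is a convention. *)
fun matrix_tensor_power :: "real^'n^'n::finite \<Rightarrow> real^'n^'n \<Rightarrow> nat \<Rightarrow> real^'n^'n" where
  "matrix_tensor_power G T 0 = G"
| "matrix_tensor_power G T (Suc 0) = T"
| "matrix_tensor_power G T (Suc (Suc p)) =
     transpose (assoc_operator G T) ** matrix_tensor_power G T (Suc p)"

definition tensor_power ::
  "('a, 'n::finite) semi_riem \<Rightarrow> ('a, 'n) tensor2 \<Rightarrow> nat \<Rightarrow> ('a, 'n) tensor2" where
  "tensor_power M T k = (\<lambda>u p. matrix_tensor_power (metric M u p) (T u p) k)"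

(* tr(T) at p; the trace of the associated operator is the same in all charts around p. *)
definition tensor_trace :: "('a, 'n::finite) semi_riem \<Rightarrow> ('a, 'n) tensor2 \<Rightarrow> 'a \<Rightarrow> real" where
  "tensor_trace M T p =
     (THE t. \<forall>u\<in>charts_at M p. t = trace (assoc_operator (metric M u p) (T u p)))"

definition lin_comb_at ::
  "('a, 'n::finite) semi_riem \<Rightarrow> 'a \<Rightarrow> ('a, 'n) tensor2 \<Rightarrow> ('a, 'n) tensor2 \<Rightarrow> ('a, 'n) tensor2 \<Rightarrow> bool"
  where
  "lin_comb_at M p T T1 T2 \<longleftrightarrow>
     (\<exists>\<alpha> \<beta>. \<forall>u\<in>charts_at M p. T u p = \<alpha> *\<^sub>R T1 u p + \<beta> *\<^sub>R T2 u p)"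

definition partially_einstein_at :: "('a, 'n::finite) semi_riem \<Rightarrow> 'a \<Rightarrow> bool" where
  "partially_einstein_at M p \<longleftrightarrow> lin_comb_at M p (tensor_power M (ricci M) 2) (ricci M) (metric M)"

definition scalar_curvature :: "('a, 'n::finite) semi_riem \<Rightarrow> 'a \<Rightarrow> real" where
  "scalar_curvature M p = tensor_trace M (ricci M) p"

(* For dimension n + 1 = CARD('m), the constant is c = (scalar curvature) / (n (n + 1)). *)
definition space_of_constant_curvature ::
  "('b, 'm::finite) semi_riem \<Rightarrow> nat \<Rightarrow> real \<Rightarrow> bool" where
  "space_of_constant_curvature N s c \<longleftrightarrow>
     semi_riemannian N \<and> has_index N s \<and>
     (\<forall>p\<in>topspace (topo N).
        c = scalar_curvature N p / (real (CARD('m) - 1) * real CARD('m)) \<and>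
        (\<forall>u\<in>charts_at N p. \<forall>h i j k. riemann N u p h i j k =
           c * (metric N u p $ h $ k * metric N u p $ i $ j
                - metric N u p $ h $ j * metric N u p $ i $ k)))"


section \<open>Hypersurfaces\<close>

definition smooth_map ::
  "('a, 'n::finite) semi_riem \<Rightarrow> ('b, 'm::finite) semi_riem \<Rightarrow> ('a \<Rightarrow> 'b) \<Rightarrow> bool" where
  "smooth_map M N f \<longleftrightarrow>
     continuous_map (topo M) (topo N) f \<and>
     (\<forall>u\<in>atlas M. \<forall>v\<in>atlas N. \<forall>a.
        smooth_fun_on (chart_image u (f -` fst v)) (coord_rep u (\<lambda>q. snd v (f q) $ a)))"

(* The matrix of the differential of f at p in the charts u around p and v around f p. *)
definition differential ::
  "('a \<Rightarrow> 'b) \<Rightarrow> ('a, 'n::finite) chart \<Rightarrow> ('b, 'm::finite) chart \<Rightarrow> 'a \<Rightarrow> real^'n^'m" where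
  "differential f u v p = (\<chi> a i. chart_pd u i (\<lambda>q. snd v (f q) $ a) p)"

definition isometric_immersion ::
  "('a, 'n::finite) semi_riem \<Rightarrow> ('b, 'm::finite) semi_riem \<Rightarrow> ('a \<Rightarrow> 'b) \<Rightarrow> bool" where
  "isometric_immersion M N f \<longleftrightarrow>
     smooth_map M N f \<and>
     (\<forall>p\<in>topspace (topo M). \<forall>u\<in>charts_at M p. \<forall>v\<in>charts_at N (f p).
        inj ((*v) (differential f u v p)) \<and>
        metric M u p = transpose (differential f u v p) ** metric N v (f p) ** differential f u v p)"

definition hypersurface ::
  "('a, 'n::finite) semi_riem \<Rightarrow> ('b, 'm::finite) semi_riem \<Rightarrow> ('a \<Rightarrow> 'b) \<Rightarrow> bool" where
  "hypersurface M N f \<longleftrightarrow>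
     semi_riemannian M \<and> semi_riemannian N \<and> CARD('m) = CARD('n) + 1 \<and>
     isometric_immersion M N f"

(* \<xi> p, a tangent vector of N at f p given by its components \<xi> p v in all charts v around f p,
   is normal to f with square \<epsilon>.  No continuity in p is required: H at p depends only on \<xi> p,
   and hypersurfaces without a global smooth unit normal field are thus included. *)
definition unit_normal ::
  "('a, 'n::finite) semi_riem \<Rightarrow> ('b, 'm::finite) semi_riem \<Rightarrow> ('a \<Rightarrow> 'b) \<Rightarrow>
   ('a \<Rightarrow> ('b, 'm) chart \<Rightarrow> real^'m) \<Rightarrow> real \<Rightarrow> bool" where
  "unit_normal M N f \<xi> \<epsilon> \<longleftrightarrow>
     (\<epsilon> = 1 \<or> \<epsilon> = -1) \<and>
     (\<forall>p\<in>topspace (topo M). \<forall>v\<in>charts_at N (f p).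
        (\<forall>w\<in>charts_at N (f p). \<xi> p w = transition v w (f p) *v \<xi> p v) \<and>
        (\<forall>u\<in>charts_at M p. \<forall>i. column i (differential f u v p) \<bullet> (metric N v (f p) *v \<xi> p v) = 0) \<and>
        \<xi> p v \<bullet> (metric N v (f p) *v \<xi> p v) = \<epsilon>)"

(* The components in v of the covariant derivative in N, along f, of f_*(d_j) in direction d_i. *)
definition hessian_along ::
  "('b, 'm::finite) semi_riem \<Rightarrow> ('a \<Rightarrow> 'b) \<Rightarrow> ('a, 'n::finite) chart \<Rightarrow> ('b, 'm) chart \<Rightarrow>
   'a \<Rightarrow> 'n \<Rightarrow> 'n \<Rightarrow> real^'m" where
  "hessian_along N f u v p i j =
     (\<chi> a. chart_pd u i (\<lambda>q. differential f u v q $ a $ j) p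
        + (\<Sum>b\<in>UNIV. \<Sum>d\<in>UNIV. christoffel N v (f p) a b d
             * differential f u v p $ b $ i * differential f u v p $ d $ j))"

(* By the Gauss formula \<nabla>'_X f_*Y = f_*(\<nabla>_X Y) + \<epsilon> H(X,Y) \<xi>, with \<nabla>' the connection of N,
   H(X,Y) is the product of \<nabla>'_X f_*Y and \<xi>.  The shape operator is the operator associated
   with H. *)
definition second_fundamental_tensor ::
  "('a, 'n::finite) semi_riem \<Rightarrow> ('b, 'm::finite) semi_riem \<Rightarrow> ('a \<Rightarrow> 'b) \<Rightarrow>
   ('a \<Rightarrow> ('b, 'm) chart \<Rightarrow> real^'m) \<Rightarrow> ('a, 'n) tensor2 \<Rightarrow> bool" where
  "second_fundamental_tensor M N f \<xi> H \<longleftrightarrow>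
     tensor_field M H \<and>
     (\<forall>p\<in>topspace (topo M). \<forall>u\<in>charts_at M p. \<forall>v\<in>charts_at N (f p). \<forall>i j.
        H u p $ i $ j = hessian_along N f u v p i j \<bullet> (metric N v (f p) *v \<xi> p v))"

definition \<U>\<^sub>H :: "('a, 'n::finite) semi_riem \<Rightarrow> ('a, 'n) tensor2 \<Rightarrow> 'a set" where
  "\<U>\<^sub>H M H = {p \<in> topspace (topo M). \<not> lin_comb_at M p (tensor_power M H 2) H (metric M)}"

end

theory Submission
  imports Defs
begin

text \<open>
  The theorem is a comparison of coefficients, once the Ricci tensor is known in terms of \<open>H\<close>.
  Contracting the Gauss equation gives the Ricci operator of the hypersurface as a quadratic
  polynomial in the shape operator \<open>\<A>\<close>: with \<open>t = tr \<A>\<close> and \<open>\<kappa> = (n - 1) c\<close>, it is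
  \<open>\<epsilon> (t \<A> - \<A>\<^sup>2) + \<kappa>\<close> (\<open>ricci_hypersurface\<close>).
  The cubic relation for \<open>\<A>\<close> reduces the square of this operator to a combination of \<open>\<A>\<^sup>2\<close>, \<open>\<A>\<close>
  and the identity (\<open>square_of_quadratic_operator\<close>), and the partial Einstein condition, with
  coefficients \<open>\<alpha>\<close> and \<open>\<beta>\<close>, expresses it as another such combination. On \<open>\<U>\<^sub>H\<close> the three operators
  are linearly independent (\<open>quadratic_operator_independent\<close>), so the coefficients agree. For \<open>\<A>\<^sup>2\<close>
  this gives \<open>\<alpha> = 2 \<kappa> - \<epsilon> (\<psi> + (\<phi> - t)\<^sup>2) = \<rho>1\<close>, for the identity \<open>\<beta> = \<rho>0\<close>, and for \<open>\<A>\<close>,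
  after substituting \<open>\<alpha>\<close>, the equation \<open>\<tau> = 0\<close>.

  The bulk of the work is the Gauss equation itself, derived from the Christoffel symbols of the two
  metrics in a pair of charts. The covariant derivative of \<open>N\<close> along the immersion is written as the
  flat derivative plus a connection matrix; it is compatible with the metric
  (\<open>chart_pd_amb_prod\<close>), its derivatives of coordinate fields are symmetric (\<open>hess_sym\<close>), and its
  curvature is the pulled-back curvature of \<open>N\<close> (\<open>cov_along_commutator\<close>, \<open>conn_curv_component\<close>).
  Splitting the derivatives of coordinate fields into tangential and normal parts then yields the
  equation in any codimension, with a vector-valued second fundamental form (\<open>Gauss_equation\<close>). Only
  afterwards is this form expressed through a unit normal vector, at one point
  (\<open>Gauss_equation_hypersurface\<close>); in this way no regularity of the normal field is involved.
  The analytic ingredients are the symmetry of second derivatives (\<open>partial_deriv_commute\<close>) and the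
  differentiability of the inverse metric (\<open>chart_diff_matrix_inv\<close>).
\<close>

section \<open>Partial derivatives in Euclidean space\<close>

lemma partial_deriv_eqI:
  "(F has_derivative F') (at x) \<Longrightarrow> partial_deriv i F x = F' (axis i 1)"
  unfolding partial_deriv_def using frechet_derivative_at by metis

lemma partial_deriv_const: "partial_deriv i (\<lambda>x. a) x = 0"
  by (simp add: partial_deriv_eqI[OF has_derivative_const])

lemma partial_deriv_add:
  assumes "F differentiable at x" "G differentiable at x"
  shows "partial_deriv i (\<lambda>x. F x + G x) x = partial_deriv i F x + partial_deriv i G x"
  by (subst partial_deriv_eqI[OF has_derivative_add[OF assms[unfolded frechet_derivative_works]]])
    (simp add: partial_deriv_def)

lemma partial_deriv_mult:
  assumes "F differentiable at x" "G differentiable at x"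
  shows "partial_deriv i (\<lambda>x. F x * G x) x = partial_deriv i F x * G x + F x * partial_deriv i G x"
  by (subst partial_deriv_eqI[OF has_derivative_mult[OF assms[unfolded frechet_derivative_works]]])
    (simp add: partial_deriv_def)

lemma partial_deriv_chain:
  fixes F :: "real^'n::finite \<Rightarrow> real^'m::finite"
  assumes "F differentiable at x" "K differentiable at (F x)"
  shows "partial_deriv i (\<lambda>x. K (F x)) x =
    (\<Sum>b\<in>UNIV. partial_deriv b K (F x) * partial_deriv i (\<lambda>x. F x $ b) x)"
proof -
  let ?F' = "frechet_derivative F (at x)" and ?K' = "frechet_derivative K (at (F x))"
  have F: "(F has_derivative ?F') (at x)" and K: "(K has_derivative ?K') (at (F x))"
    using assms by (simp_all add: frechet_derivative_works[symmetric])
  have comp: "partial_deriv i (\<lambda>x. F x $ b) x = ?F' (axis i 1) $ b" for b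
    by (rule partial_deriv_eqI) (rule bounded_linear.has_derivative[OF bounded_linear_vec_nth F])
  have lin: "linear ?K'"
    using K by (rule has_derivative_linear)
  have "partial_deriv i (\<lambda>x. K (F x)) x = ?K' (?F' (axis i 1))"
    by (rule partial_deriv_eqI) (rule has_derivative_compose[OF F K])
  also have "\<dots> = ?K' (\<Sum>b\<in>UNIV. (?F' (axis i 1) $ b) *\<^sub>R axis b 1)"
    by (simp add: basis_expansion flip: scalar_mult_eq_scaleR)
  also have "\<dots> = (\<Sum>b\<in>UNIV. (?F' (axis i 1) $ b) * ?K' (axis b 1))"
    by (simp add: linear_sum[OF lin] linear_scale[OF lin])
  finally show ?thesis
    unfolding comp by (simp add: partial_deriv_def mult.commute)
qed

lemma differentiable_prod_real:
  fixes F :: "'i \<Rightarrow> real^'n::finite \<Rightarrow> real"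
  assumes "\<And>i. i \<in> I \<Longrightarrow> F i differentiable at x"
  shows "(\<lambda>x. \<Prod>i\<in>I. F i x) differentiable at x"
  using has_derivative_prod[of I F "\<lambda>i. frechet_derivative (F i) (at x)" x UNIV] assms
  unfolding frechet_derivative_works[symmetric] differentiable_def by blast

lemma partial_deriv_cong_open:
  assumes "open S" "x \<in> S" "\<And>y. y \<in> S \<Longrightarrow> F y = G y"
  shows "F differentiable at x \<longleftrightarrow> G differentiable at x"
    and "partial_deriv i F x = partial_deriv i G x"
proof -
  have iff: "(F has_derivative D) (at x) \<longleftrightarrow> (G has_derivative D) (at x)" for D
    using has_derivative_transform_within_open[of F D x UNIV S G]
      has_derivative_transform_within_open[of G D x UNIV S F] assms by auto
  then show "F differentiable at x \<longleftrightarrow> G differentiable at x"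
    by (auto simp: differentiable_def)
  show "partial_deriv i F x = partial_deriv i G x"
    by (simp add: partial_deriv_def frechet_derivative_def iff)
qed

lemma Ck_on_cong:
  assumes "open S" "\<And>y. y \<in> S \<Longrightarrow> F y = G y"
  shows "Ck_on k S F \<longleftrightarrow> Ck_on k S G"
  using assms(2)
proof (induction k arbitrary: F G)
  case 0
  then show ?case by (simp cong: continuous_on_cong)
next
  case (Suc k)
  have "Ck_on k S (partial_deriv i F) \<longleftrightarrow> Ck_on k S (partial_deriv i G)" for i
    by (rule Suc.IH) (rule partial_deriv_cong_open[OF assms(1) _ Suc.prems])
  moreover have "F differentiable at x \<longleftrightarrow> G differentiable at x" if "x \<in> S" for x
    by (rule partial_deriv_cong_open[OF assms(1) that Suc.prems])
  ultimately show ?case by simp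
qed

lemma smooth_fun_on_cong:
  "open S \<Longrightarrow> (\<And>y. y \<in> S \<Longrightarrow> F y = G y) \<Longrightarrow> smooth_fun_on S F \<longleftrightarrow> smooth_fun_on S G"
  unfolding smooth_fun_on_def using Ck_on_cong by blast

lemma smooth_fun_on_differentiable:
  "smooth_fun_on S F \<Longrightarrow> x \<in> S \<Longrightarrow> F differentiable at x"
  unfolding smooth_fun_on_def by (metis Ck_on.simps(2))

lemma smooth_fun_on_partial_deriv:
  "smooth_fun_on S F \<Longrightarrow> smooth_fun_on S (partial_deriv i F)"
  unfolding smooth_fun_on_def by (metis Ck_on.simps(2))

lemma smooth_fun_on_subset:
  assumes "smooth_fun_on S F" "T \<subseteq> S"
  shows "smooth_fun_on T F"
proof -
  have "Ck_on k S F \<Longrightarrow> Ck_on k T F" for k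
    using assms(2) by (induction k arbitrary: F) (auto intro: continuous_on_subset)
  then show ?thesis
    using assms(1) by (simp add: smooth_fun_on_def)
qed

lemma smooth_fun_on_continuous: "smooth_fun_on S F \<Longrightarrow> continuous_on S F"
  unfolding smooth_fun_on_def by (metis Ck_on.simps(1))

lemma partial_deriv_along_line:
  assumes "F differentiable at (x + t *\<^sub>R axis i 1)"
  shows "((\<lambda>t. F (x + t *\<^sub>R axis i 1)) has_real_derivative partial_deriv i F (x + t *\<^sub>R axis i 1)) (at t)"
proof -
  let ?y = "x + t *\<^sub>R axis i 1"
  have F: "(F has_derivative frechet_derivative F (at ?y)) (at ?y)"
    using assms by (simp add: frechet_derivative_works[symmetric])
  have l: "((\<lambda>t. x + t *\<^sub>R axis i 1) has_derivative (\<lambda>h. h *\<^sub>R axis i 1)) (at t)"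
    by (auto intro!: derivative_eq_intros)
  have lin: "linear (frechet_derivative F (at ?y))"
    using F by (rule has_derivative_linear)
  show ?thesis
    using has_derivative_compose[OF l F]
    by (simp add: has_field_derivative_def linear_scale[OF lin] partial_deriv_def mult_commute_abs)
qed

text \<open>Two applications of the mean value theorem, first along the \<open>i\<close>-th and then along the
  \<open>j\<close>-th axis. The left-hand side is symmetric in \<open>i\<close> and \<open>j\<close>, so exchanging them expresses
  the same number through the other mixed derivative; this drives \<open>partial_deriv_commute\<close>.\<close>

lemma second_difference:
  fixes F :: "real^'n::finite \<Rightarrow> real"
  assumes "0 < h"
    and F: "\<And>s t. 0 \<le> s \<Longrightarrow> s \<le> h \<Longrightarrow> 0 \<le> t \<Longrightarrow> t \<le> h \<Longrightarrow>
      F differentiable at (x + s *\<^sub>R axis i 1 + t *\<^sub>R axis j 1)"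
    and F': "\<And>s t. 0 \<le> s \<Longrightarrow> s \<le> h \<Longrightarrow> 0 \<le> t \<Longrightarrow> t \<le> h \<Longrightarrow>
      partial_deriv i F differentiable at (x + s *\<^sub>R axis i 1 + t *\<^sub>R axis j 1)"
  shows "\<exists>s t. 0 < s \<and> s < h \<and> 0 < t \<and> t < h \<and>
    F (x + h *\<^sub>R axis i 1 + h *\<^sub>R axis j 1) - F (x + h *\<^sub>R axis i 1) - F (x + h *\<^sub>R axis j 1) + F x
     = h\<^sup>2 * partial_deriv j (partial_deriv i F) (x + s *\<^sub>R axis i 1 + t *\<^sub>R axis j 1)"
proof -
  let ?a = "axis i 1 :: real^'n" and ?b = "axis j 1 :: real^'n"
  let ?D = "\<lambda>s. F (x + s *\<^sub>R ?a + h *\<^sub>R ?b) - F (x + s *\<^sub>R ?a)"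
  have swap: "x + s *\<^sub>R ?a + t *\<^sub>R ?b = (x + t *\<^sub>R ?b) + s *\<^sub>R ?a" for s t
    by simp
  have "(?D has_real_derivative
      partial_deriv i F (x + s *\<^sub>R ?a + h *\<^sub>R ?b) - partial_deriv i F (x + s *\<^sub>R ?a)) (at s)"
    if "0 \<le> s" "s \<le> h" for s
    unfolding swap
    using F[of s h] F[of s 0] that assms(1)
    by (intro DERIV_diff partial_deriv_along_line) (simp_all add: algebra_simps)
  from MVT2[OF assms(1) this] obtain s where s: "0 < s" "s < h" and
    1: "?D h - ?D 0 = h * (partial_deriv i F (x + s *\<^sub>R ?a + h *\<^sub>R ?b) - partial_deriv i F (x + s *\<^sub>R ?a))"
    by auto
  have "((\<lambda>t. partial_deriv i F (x + s *\<^sub>R ?a + t *\<^sub>R ?b)) has_real_derivative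
      partial_deriv j (partial_deriv i F) (x + s *\<^sub>R ?a + t *\<^sub>R ?b)) (at t)"
    if "0 \<le> t" "t \<le> h" for t
    using F'[of s t] that s by (intro partial_deriv_along_line) auto
  from MVT2[OF assms(1) this] obtain t where t: "0 < t" "t < h" and
    2: "partial_deriv i F (x + s *\<^sub>R ?a + h *\<^sub>R ?b) - partial_deriv i F (x + s *\<^sub>R ?a) =
      h * partial_deriv j (partial_deriv i F) (x + s *\<^sub>R ?a + t *\<^sub>R ?b)"
    by auto
  show ?thesis
    using 1 s t unfolding 2
    by (intro exI[of _ s] exI[of _ t]) (simp add: power2_eq_square algebra_simps)
qed

text \<open>If the two mixed derivatives differed at \<open>x\<close>, continuity would keep them apart on a small
  ball, whereas by \<open>second_difference\<close> both of them attain, somewhere in that ball, the value of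
  the same difference quotient.\<close>

lemma partial_deriv_commute:
  fixes F :: "real^'n::finite \<Rightarrow> real"
  assumes "smooth_fun_on S F" "open S" "x \<in> S"
  shows "partial_deriv i (partial_deriv j F) x = partial_deriv j (partial_deriv i F) x"
proof (rule ccontr)
  let ?P = "partial_deriv i (partial_deriv j F)" and ?Q = "partial_deriv j (partial_deriv i F)"
  assume "?P x \<noteq> ?Q x"
  define e where "e = \<bar>?P x - ?Q x\<bar> / 2"
  have e: "e > 0"
    using \<open>?P x \<noteq> ?Q x\<close> by (simp add: e_def)
  have "isCont ?P x" "isCont ?Q x"
    using assms smooth_fun_on_continuous smooth_fun_on_partial_deriv
    by (metis continuous_on_eq_continuous_at)+
  then obtain d1 d2 where d1: "d1 > 0" "\<And>y. dist y x < d1 \<Longrightarrow> dist (?P y) (?P x) < e"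
    and d2: "d2 > 0" "\<And>y. dist y x < d2 \<Longrightarrow> dist (?Q y) (?Q x) < e"
    using e unfolding continuous_at_eps_delta by (metis dist_commute)
  obtain d3 where d3: "d3 > 0" "ball x d3 \<subseteq> S"
    using assms openE by blast
  define h where "h = Min {d1, d2, d3} / 3"
  have h: "h > 0" "3 * h \<le> d1" "3 * h \<le> d2" "3 * h \<le> d3"
    using d1 d2 d3 by (auto simp: h_def)
  have near: "dist (x + s *\<^sub>R axis k 1 + t *\<^sub>R axis l 1) x < 3 * h"
    if "0 \<le> s" "s \<le> h" "0 \<le> t" "t \<le> h" for s t and k l :: 'n
  proof -
    have "dist (x + s *\<^sub>R axis k 1 + t *\<^sub>R axis l 1) x = norm (s *\<^sub>R axis k (1::real) + t *\<^sub>R axis l 1)"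
      by (simp add: dist_norm)
    also have "\<dots> \<le> norm (s *\<^sub>R axis k (1::real)) + norm (t *\<^sub>R axis l (1::real))"
      by (rule norm_triangle_ineq)
    also have "\<dots> = s + t"
      using that by (simp add: norm_axis_1)
    finally show ?thesis using that h by simp
  qed
  have inS: "x + s *\<^sub>R axis k 1 + t *\<^sub>R axis l 1 \<in> S"
    if "0 \<le> s" "s \<le> h" "0 \<le> t" "t \<le> h" for s t and k l :: 'n
    using near[OF that, of k l] d3 h by (intro subsetD[OF d3(2)]) (auto simp: dist_commute)
  have dF: "F differentiable at y" "partial_deriv k F differentiable at y" if "y \<in> S" for y k
    using assms that smooth_fun_on_differentiable smooth_fun_on_partial_deriv by blast+
  obtain s t where st: "0 < s" "s < h" "0 < t" "t < h" and
    1: "F (x + h *\<^sub>R axis i 1 + h *\<^sub>R axis j 1) - F (x + h *\<^sub>R axis i 1) - F (x + h *\<^sub>R axis j 1) + F x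
     = h\<^sup>2 * ?Q (x + s *\<^sub>R axis i 1 + t *\<^sub>R axis j 1)"
    using second_difference[OF h(1), of F x i j] dF inS by blast
  obtain s' t' where st': "0 < s'" "s' < h" "0 < t'" "t' < h" and
    2: "F (x + h *\<^sub>R axis j 1 + h *\<^sub>R axis i 1) - F (x + h *\<^sub>R axis j 1) - F (x + h *\<^sub>R axis i 1) + F x
     = h\<^sup>2 * ?P (x + s' *\<^sub>R axis j 1 + t' *\<^sub>R axis i 1)"
    using second_difference[OF h(1), of F x j i] dF inS by blast
  have "h\<^sup>2 * ?Q (x + s *\<^sub>R axis i 1 + t *\<^sub>R axis j 1) = h\<^sup>2 * ?P (x + s' *\<^sub>R axis j 1 + t' *\<^sub>R axis i 1)"
    unfolding 1[symmetric] 2[symmetric] by (simp add: add_ac)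
  then have "?Q (x + s *\<^sub>R axis i 1 + t *\<^sub>R axis j 1) = ?P (x + s' *\<^sub>R axis j 1 + t' *\<^sub>R axis i 1)"
    using h(1) by simp
  moreover have "dist (?Q (x + s *\<^sub>R axis i 1 + t *\<^sub>R axis j 1)) (?Q x) < e"
    using near[of s t i j] st h by (intro d2(2)) simp
  moreover have "dist (?P (x + s' *\<^sub>R axis j 1 + t' *\<^sub>R axis i 1)) (?P x) < e"
    using near[of s' t' j i] st' h by (intro d1(2)) simp
  ultimately show False
    by (simp add: dist_real_def e_def field_simps abs_if split: if_splits)
qed

lemma det_differentiable:
  fixes A :: "real^'k::finite \<Rightarrow> real^'n^'n::finite"
  assumes "\<And>i j. (\<lambda>y. A y $ i $ j) differentiable at x"
  shows "(\<lambda>y. det (A y)) differentiable at x"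
proof -
  have "(\<lambda>y. \<Prod>i\<in>UNIV. A y $ i $ p i) differentiable at x" for p
    by (rule differentiable_prod_real) (rule assms)
  then show ?thesis
    unfolding det_def by (intro differentiable_sum differentiable_mult differentiable_const) auto
qed

lemma matrix_inv_works:
  assumes "invertible (A::real^'n^'n::finite)"
  shows "A ** matrix_inv A = mat 1" "matrix_inv A ** A = mat 1"
  using assms unfolding invertible_def matrix_inv_def
  by (metis (mono_tags, lifting) someI_ex)+

text \<open>Writing the entries of the inverse as quotients of determinants makes them differentiable
  functions of the entries of the matrix; the Christoffel symbols need this.\<close>

lemma matrix_inv_cramer:
  fixes A :: "real^'n^'n::finite"
  assumes "invertible A"
  shows "matrix_inv A $ k $ l = det (\<chi> i j. if j = k then (if i = l then 1 else 0) else A $ i $ j) / det A"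
proof -
  have d: "det A \<noteq> 0"
    using assms by (simp add: invertible_det_nz)
  have "A *v column l (matrix_inv A) = column l (A ** matrix_inv A)"
    by (simp add: vec_eq_iff matrix_vector_mult_def matrix_matrix_mult_def column_def)
  also have "\<dots> = (\<chi> i. if i = l then 1 else 0)"
    by (simp add: matrix_inv_works[OF assms] column_def mat_def vec_eq_iff)
  finally have "column l (matrix_inv A) =
      (\<chi> k. det (\<chi> i j. if j = k then (\<chi> i. if i = l then 1 else 0) $ i else A $ i $ j) / det A)"
    using cramer[OF d] by blast
  then have "column l (matrix_inv A) $ k =
      det (\<chi> i j. if j = k then (if i = l then 1 else 0) else A $ i $ j) / det A"
    by (simp cong: if_cong)
  then show ?thesis
    by (simp add: column_def)
qed

section \<open>Calculus in a coordinate chart\<close>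

text \<open>Derivatives are taken directly of functions on the manifold. Since \<open>coord_rep u\<close> is a mere
  composition, it commutes definitionally with all pointwise operations, and the rules of the
  Euclidean calculus carry over without any translation into coordinates.\<close>

definition chart_diff :: "('a, 'n::finite) chart \<Rightarrow> ('a \<Rightarrow> real) \<Rightarrow> 'a \<Rightarrow> bool" where
  "chart_diff u K p \<longleftrightarrow> coord_rep u K differentiable (at (snd u p))"

lemma coord_rep_eq: "coord_rep u K = (\<lambda>x. K (inv_into (fst u) (snd u) x))"
  by (simp add: coord_rep_def o_def)

lemma chart_diff_const: "chart_diff u (\<lambda>q. a) p"
  by (simp add: chart_diff_def coord_rep_eq)

lemma chart_diff_add: "chart_diff u K p \<Longrightarrow> chart_diff u L p \<Longrightarrow> chart_diff u (\<lambda>q. K q + L q) p"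
  by (simp add: chart_diff_def coord_rep_eq differentiable_add)

lemma chart_diff_diff: "chart_diff u K p \<Longrightarrow> chart_diff u L p \<Longrightarrow> chart_diff u (\<lambda>q. K q - L q) p"
  by (simp add: chart_diff_def coord_rep_eq differentiable_diff)

lemma chart_diff_mult: "chart_diff u K p \<Longrightarrow> chart_diff u L p \<Longrightarrow> chart_diff u (\<lambda>q. K q * L q) p"
  by (simp add: chart_diff_def coord_rep_eq differentiable_mult)

lemma chart_diff_sum:
  "finite I \<Longrightarrow> (\<And>k. k \<in> I \<Longrightarrow> chart_diff u (K k) p) \<Longrightarrow> chart_diff u (\<lambda>q. \<Sum>k\<in>I. K k q) p"
  by (simp add: chart_diff_def coord_rep_eq differentiable_sum)

lemmas chart_diff_intros =
  chart_diff_const chart_diff_add chart_diff_diff chart_diff_mult chart_diff_sum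

lemma chart_pd_const: "chart_pd u i (\<lambda>q. a) p = 0"
  by (simp add: chart_pd_def coord_rep_eq partial_deriv_const)

lemma chart_pd_add:
  "chart_diff u K p \<Longrightarrow> chart_diff u L p \<Longrightarrow>
    chart_pd u i (\<lambda>q. K q + L q) p = chart_pd u i K p + chart_pd u i L p"
  by (simp add: chart_diff_def chart_pd_def coord_rep_eq partial_deriv_add)

lemma chart_pd_sum:
  assumes "finite I" "\<And>k. k \<in> I \<Longrightarrow> chart_diff u (K k) p"
  shows "chart_pd u i (\<lambda>q. \<Sum>k\<in>I. K k q) p = (\<Sum>k\<in>I. chart_pd u i (K k) p)"
  using assms
  by (induction I rule: finite_induct) (simp_all add: chart_pd_const chart_pd_add chart_diff_sum)

text \<open>The open set \<open>W\<close> inside the chart domain is where identities between functions are known to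
  hold; along an immersion it is the part of the domain that is mapped into a given chart of the
  ambient space.\<close>

locale chart_domain =
  fixes X :: "'a topology" and u :: "('a, 'n::finite) chart" and W :: "'a set"
  assumes chart: "is_chart X u" and openin_W: "openin X W" and W_subset: "W \<subseteq> fst u"
begin

lemma topspace_chart: "topspace (subtopology X (fst u)) = fst u"
  using chart openin_subset by (auto simp: is_chart_def)

lemma inv_chart: "p \<in> W \<Longrightarrow> inv_into (fst u) (snd u) (snd u p) = p"
  using chart W_subset homeomorphic_imp_injective_map topspace_chart
  unfolding is_chart_def by (metis inv_into_f_f subsetD)

lemma open_chart_image: "open (snd u ` W)"
proof -
  have "open_map (subtopology X (fst u)) (top_of_set (snd u ` fst u)) (snd u)"
    using chart homeomorphic_imp_open_map by (auto simp: is_chart_def)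
  moreover have "openin (subtopology X (fst u)) W"
    using openin_W W_subset openin_subtopology by blast
  ultimately have "openin (top_of_set (snd u ` fst u)) (snd u ` W)"
    by (simp add: open_map_def)
  then show ?thesis
    using chart openin_open_trans unfolding is_chart_def by blast
qed

lemma coord_rep_chart: "p \<in> W \<Longrightarrow> coord_rep u K (snd u p) = K p"
  by (simp add: coord_rep_eq inv_chart)

lemma chart_pd_mult:
  "p \<in> W \<Longrightarrow> chart_diff u K p \<Longrightarrow> chart_diff u L p \<Longrightarrow>
    chart_pd u i (\<lambda>q. K q * L q) p = chart_pd u i K p * L p + K p * chart_pd u i L p"
  by (simp add: chart_diff_def chart_pd_def coord_rep_eq partial_deriv_mult inv_chart)

lemma chart_diff_cong:
  assumes "p \<in> W" "\<And>q. q \<in> W \<Longrightarrow> K q = L q"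
  shows "chart_diff u K p \<longleftrightarrow> chart_diff u L p"
  unfolding chart_diff_def
  by (rule partial_deriv_cong_open[OF open_chart_image]) (use assms in \<open>auto simp: coord_rep_chart\<close>)

lemma chart_pd_cong:
  assumes "p \<in> W" "\<And>q. q \<in> W \<Longrightarrow> K q = L q"
  shows "chart_pd u i K p = chart_pd u i L p"
  unfolding chart_pd_def
  by (rule partial_deriv_cong_open[OF open_chart_image]) (use assms in \<open>auto simp: coord_rep_chart\<close>)

definition chart_smooth :: "('a \<Rightarrow> real) \<Rightarrow> bool" where
  "chart_smooth K \<longleftrightarrow> smooth_fun_on (snd u ` W) (coord_rep u K)"

lemma chart_smooth_diff: "chart_smooth K \<Longrightarrow> p \<in> W \<Longrightarrow> chart_diff u K p"
  unfolding chart_smooth_def chart_diff_def using smooth_fun_on_differentiable by blast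

text \<open>Partial differentiation in a chart can be iterated: the coordinate representation of a
  derivative is the derivative of the coordinate representation.\<close>

lemma coord_rep_chart_pd:
  "x \<in> snd u ` W \<Longrightarrow> coord_rep u (chart_pd u i K) x = partial_deriv i (coord_rep u K) x"
  by (auto simp: coord_rep_chart chart_pd_def)

lemma chart_smooth_pd: "chart_smooth K \<Longrightarrow> chart_smooth (chart_pd u i K)"
  unfolding chart_smooth_def
  using smooth_fun_on_cong[OF open_chart_image, of "coord_rep u (chart_pd u i K)"
      "partial_deriv i (coord_rep u K)"] coord_rep_chart_pd smooth_fun_on_partial_deriv
  by blast

lemma chart_pd_commute:
  assumes "chart_smooth K" "p \<in> W"
  shows "chart_pd u i (chart_pd u j K) p = chart_pd u j (chart_pd u i K) p"
proof -
  have "chart_pd u i (chart_pd u j K) p = partial_deriv i (partial_deriv j (coord_rep u K)) (snd u p)"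
    for i j
    unfolding chart_pd_def[of u i]
    by (rule partial_deriv_cong_open[OF open_chart_image])
      (use assms in \<open>auto simp: coord_rep_chart_pd\<close>)
  then show ?thesis
    using partial_deriv_commute[OF _ open_chart_image] assms unfolding chart_smooth_def by auto
qed

lemma chart_diff_matrix_inv:
  fixes g :: "'a \<Rightarrow> real^'k^'k::finite"
  assumes p: "p \<in> W" and inv: "\<And>q. q \<in> W \<Longrightarrow> invertible (g q)"
    and diff: "\<And>i j. chart_diff u (\<lambda>q. g q $ i $ j) p"
  shows "chart_diff u (\<lambda>q. matrix_inv (g q) $ k $ l) p"
proof -
  let ?B = "\<lambda>q. \<chi> i j. if j = k then (if i = l then 1 else 0) else g q $ i $ j"
  have g: "(\<lambda>x. g (inv_into (fst u) (snd u) x) $ i $ j) differentiable at (snd u p)" for i j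
    using diff by (simp add: chart_diff_def coord_rep_eq)
  have "(\<lambda>x. ?B (inv_into (fst u) (snd u) x) $ i $ j) differentiable at (snd u p)" for i j
    by (cases "j = k") (simp_all add: g)
  then have "(\<lambda>x. det (?B (inv_into (fst u) (snd u) x))) differentiable at (snd u p)"
    by (rule det_differentiable)
  moreover have "(\<lambda>x. det (g (inv_into (fst u) (snd u) x))) differentiable at (snd u p)"
    by (rule det_differentiable) (simp add: g)
  moreover have "det (g (inv_into (fst u) (snd u) (snd u p))) \<noteq> 0"
    using inv[OF p] by (simp add: inv_chart[OF p] invertible_det_nz)
  ultimately have "chart_diff u (\<lambda>q. det (?B q) / det (g q)) p"
    by (simp add: chart_diff_def coord_rep_eq differentiable_divide)
  then show ?thesis
    using chart_diff_cong[OF p, of "\<lambda>q. matrix_inv (g q) $ k $ l" "\<lambda>q. det (?B q) / det (g q)"]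
      matrix_inv_cramer[OF inv] by auto
qed

end

section \<open>The Christoffel symbols\<close>

locale metric_chart = chart_domain "topo M" u W
  for M :: "('a, 'n::finite) semi_riem" and u :: "('a, 'n) chart" and W +
  assumes semi_riem: "semi_riemannian M" and atlas: "u \<in> atlas M"
begin

abbreviation "g \<equiv> metric M u"
abbreviation "\<Gamma> \<equiv> christoffel M u"

lemma in_charts_at: "q \<in> W \<Longrightarrow> q \<in> topspace (topo M) \<and> u \<in> charts_at M q"
  using atlas W_subset openin_subset[OF openin_W] by (auto simp: charts_at_def)

lemma metric_invertible: "q \<in> W \<Longrightarrow> invertible (g q)"
  using semi_riem in_charts_at by (auto simp: semi_riemannian_def)

lemma metric_sym: "q \<in> W \<Longrightarrow> g q $ i $ j = g q $ j $ i"
  using semi_riem in_charts_at unfolding semi_riemannian_def transpose_def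
  by (metis (no_types, lifting) vec_lambda_beta)

lemma metric_smooth: "chart_smooth (\<lambda>q. g q $ i $ j)"
  unfolding chart_smooth_def
  by (rule smooth_fun_on_subset[where S = "snd u ` fst u"])
    (use semi_riem atlas W_subset in \<open>auto simp: semi_riemannian_def smooth_tensor_field_def\<close>)

lemma metric_diff: "q \<in> W \<Longrightarrow> chart_diff u (\<lambda>q. g q $ i $ j) q"
  by (rule chart_smooth_diff[OF metric_smooth])

lemma christoffel_diff:
  assumes q: "q \<in> W"
  shows "chart_diff u (\<lambda>q. \<Gamma> q k i j) q"
proof -
  have "chart_diff u (chart_pd u i (\<lambda>q. g q $ j $ l)) q" for i j l
    by (intro chart_smooth_diff[OF _ q] chart_smooth_pd metric_smooth)
  moreover have "chart_diff u (\<lambda>q. matrix_inv (g q) $ k $ l) q" for k l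
    by (rule chart_diff_matrix_inv[OF q]) (simp_all add: metric_invertible metric_diff q)
  ultimately show ?thesis
    unfolding christoffel_def by (intro chart_diff_intros) simp_all
qed

lemma metric_pd_sym: "q \<in> W \<Longrightarrow> chart_pd u k (\<lambda>q. g q $ i $ j) q = chart_pd u k (\<lambda>q. g q $ j $ i) q"
  by (rule chart_pd_cong) (simp_all add: metric_sym)

lemma christoffel_sym: "q \<in> W \<Longrightarrow> \<Gamma> q k i j = \<Gamma> q k j i"
  unfolding christoffel_def by (simp add: metric_pd_sym[of q _ i j] add.commute)

text \<open>Contracting with the metric cancels the inverse metric in the definition; what remains are
  the Christoffel symbols of the first kind.\<close>

lemma christoffel_lower:
  assumes q: "q \<in> W"
  shows "(\<Sum>k\<in>UNIV. \<Gamma> q k i j * g q $ k $ m) =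
    (chart_pd u i (\<lambda>q. g q $ j $ m) q + chart_pd u j (\<lambda>q. g q $ i $ m) q
      - chart_pd u m (\<lambda>q. g q $ i $ j) q) / 2"
proof -
  let ?D = "\<lambda>l. chart_pd u i (\<lambda>q. g q $ j $ l) q + chart_pd u j (\<lambda>q. g q $ i $ l) q
    - chart_pd u l (\<lambda>q. g q $ i $ j) q"
  have "(\<Sum>k\<in>UNIV. \<Gamma> q k i j * g q $ k $ m) =
      (\<Sum>k\<in>UNIV. \<Sum>l\<in>UNIV. (g q $ m $ k * matrix_inv (g q) $ k $ l) * ?D l / 2)"
    unfolding christoffel_def sum_distrib_left sum_distrib_right
    by (simp add: metric_sym[OF q, of _ m] mult_ac)
  also have "\<dots> = (\<Sum>l\<in>UNIV. (\<Sum>k\<in>UNIV. g q $ m $ k * matrix_inv (g q) $ k $ l) * ?D l / 2)"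
    by (subst sum.swap) (simp add: sum_distrib_right sum_divide_distrib)
  also have "\<dots> = (\<Sum>l\<in>UNIV. (if m = l then 1 else 0) * ?D l / 2)"
    using matrix_inv_works(1)[OF metric_invertible[OF q]]
    by (simp add: matrix_matrix_mult_def mat_def vec_eq_iff)
  also have "\<dots> = ?D m / 2"
    by (simp add: if_distrib[of "\<lambda>x. x * _"] if_distrib[of "\<lambda>x. x / _"] cong: if_cong)
  finally show ?thesis .
qed

text \<open>In the sum of the two symbols of the first kind, all derivatives of the metric cancel in pairs
  except the one on the left.\<close>

lemma metric_compatible:
  assumes q: "q \<in> W"
  shows "chart_pd u i (\<lambda>q. g q $ j $ m) q =
    (\<Sum>k\<in>UNIV. \<Gamma> q k i j * g q $ k $ m) + (\<Sum>k\<in>UNIV. \<Gamma> q k i m * g q $ k $ j)"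
  unfolding christoffel_lower[OF q]
  using metric_pd_sym[OF q, of i m j] metric_pd_sym[OF q, of j m i] metric_pd_sym[OF q, of m j i]
  by (simp add: field_simps)

end

section \<open>Vector- and matrix-valued functions in a chart\<close>

context chart_domain
begin

definition vec_diff :: "('a \<Rightarrow> real^'k::finite) \<Rightarrow> 'a \<Rightarrow> bool" where
  "vec_diff V q \<longleftrightarrow> (\<forall>a. chart_diff u (\<lambda>r. V r $ a) q)"

definition vec_pd :: "'n \<Rightarrow> ('a \<Rightarrow> real^'k::finite) \<Rightarrow> 'a \<Rightarrow> real^'k" where
  "vec_pd i V q = (\<chi> a. chart_pd u i (\<lambda>r. V r $ a) q)"

definition mat_diff :: "('a \<Rightarrow> real^'k::finite^'l::finite) \<Rightarrow> 'a \<Rightarrow> bool" where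
  "mat_diff A q \<longleftrightarrow> (\<forall>a b. chart_diff u (\<lambda>r. A r $ a $ b) q)"

definition mat_pd :: "'n \<Rightarrow> ('a \<Rightarrow> real^'k::finite^'l::finite) \<Rightarrow> 'a \<Rightarrow> real^'k^'l" where
  "mat_pd i A q = (\<chi> a b. chart_pd u i (\<lambda>r. A r $ a $ b) q)"

lemma vec_diff_add: "vec_diff V q \<Longrightarrow> vec_diff V' q \<Longrightarrow> vec_diff (\<lambda>r. V r + V' r) q"
  by (simp add: vec_diff_def chart_diff_add)

lemma vec_diff_diff: "vec_diff V q \<Longrightarrow> vec_diff V' q \<Longrightarrow> vec_diff (\<lambda>r. V r - V' r) q"
  by (simp add: vec_diff_def chart_diff_diff)

lemma vec_diff_scaleR: "chart_diff u K q \<Longrightarrow> vec_diff V q \<Longrightarrow> vec_diff (\<lambda>r. K r *\<^sub>R V r) q"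
  by (simp add: vec_diff_def chart_diff_mult)

lemma vec_diff_sum:
  "finite I \<Longrightarrow> (\<And>l. l \<in> I \<Longrightarrow> vec_diff (V l) q) \<Longrightarrow> vec_diff (\<lambda>r. \<Sum>l\<in>I. V l r) q"
  by (simp add: vec_diff_def chart_diff_sum)

lemma vec_diff_matrix_vector:
  "mat_diff A q \<Longrightarrow> vec_diff V q \<Longrightarrow> vec_diff (\<lambda>r. A r *v V r) q"
  by (simp add: vec_diff_def mat_diff_def matrix_vector_mult_def chart_diff_sum chart_diff_mult)

lemma vec_pd_add:
  "vec_diff V q \<Longrightarrow> vec_diff V' q \<Longrightarrow> vec_pd i (\<lambda>r. V r + V' r) q = vec_pd i V q + vec_pd i V' q"
  by (simp add: vec_diff_def vec_pd_def vec_eq_iff chart_pd_add)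

lemma vec_pd_scaleR:
  "q \<in> W \<Longrightarrow> chart_diff u K q \<Longrightarrow> vec_diff V q \<Longrightarrow>
    vec_pd i (\<lambda>r. K r *\<^sub>R V r) q = chart_pd u i K q *\<^sub>R V q + K q *\<^sub>R vec_pd i V q"
  by (simp add: vec_diff_def vec_pd_def vec_eq_iff chart_pd_mult)

lemma vec_pd_sum:
  "finite I \<Longrightarrow> (\<And>l. l \<in> I \<Longrightarrow> vec_diff (V l) q) \<Longrightarrow>
    vec_pd i (\<lambda>r. \<Sum>l\<in>I. V l r) q = (\<Sum>l\<in>I. vec_pd i (V l) q)"
  by (simp add: vec_diff_def vec_pd_def vec_eq_iff chart_pd_sum)

lemma vec_pd_matrix_vector:
  "q \<in> W \<Longrightarrow> mat_diff A q \<Longrightarrow> vec_diff V q \<Longrightarrow>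
    vec_pd i (\<lambda>r. A r *v V r) q = mat_pd i A q *v V q + A q *v vec_pd i V q"
  by (simp add: vec_diff_def mat_diff_def vec_pd_def mat_pd_def vec_eq_iff matrix_vector_mult_def
      chart_pd_sum chart_pd_mult chart_diff_mult sum.distrib)

lemma chart_pd_inner:
  "q \<in> W \<Longrightarrow> vec_diff V q \<Longrightarrow> vec_diff V' q \<Longrightarrow>
    chart_pd u i (\<lambda>r. V r \<bullet> V' r) q = vec_pd i V q \<bullet> V' q + V q \<bullet> vec_pd i V' q"
  by (simp add: vec_diff_def vec_pd_def inner_vec_def chart_pd_sum chart_pd_mult chart_diff_mult
      sum.distrib)

end

section \<open>Isometric immersions in coordinates\<close>

text \<open>The codimension is arbitrary here. The setting is a chart \<open>u\<close> of \<open>M\<close> and a chart \<open>v\<close> of \<open>N\<close>;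
  vector fields along \<open>f\<close> are represented by their components in \<open>v\<close>, as functions on \<open>W\<close>.\<close>

locale immersed_patch =
  fixes M :: "('a, 'n::finite) semi_riem" and N :: "('b, 'm::finite) semi_riem"
    and f :: "'a \<Rightarrow> 'b" and u :: "('a, 'n) chart" and v :: "('b, 'm) chart"
  assumes semi_riem_M: "semi_riemannian M" and semi_riem_N: "semi_riemannian N"
    and immersion: "isometric_immersion M N f"
    and atlas_u: "u \<in> atlas M" and atlas_v: "v \<in> atlas N"
begin

abbreviation "W \<equiv> fst u \<inter> f -` fst v"

lemma charts: "is_chart (topo M) u" "is_chart (topo N) v"
  using semi_riem_M semi_riem_N atlas_u atlas_v
  by (auto simp: semi_riemannian_def smooth_manifold_def smooth_atlas_def)

lemma openin_patch: "openin (topo M) W"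
proof -
  have "openin (topo M) {q \<in> topspace (topo M). f q \<in> fst v}"
    using immersion charts(2)
    by (auto simp: isometric_immersion_def smooth_map_def is_chart_def intro: openin_continuous_map_preimage)
  moreover have u: "openin (topo M) (fst u)"
    using charts(1) by (simp add: is_chart_def)
  ultimately have "openin (topo M) (fst u \<inter> {q \<in> topspace (topo M). f q \<in> fst v})"
    by blast
  also have "fst u \<inter> {q \<in> topspace (topo M). f q \<in> fst v} = W"
    using openin_subset[OF u] by auto
  finally show ?thesis .
qed

sublocale dom: metric_chart M u W
  using charts openin_patch semi_riem_M atlas_u by unfold_locales auto

sublocale amb: metric_chart N v "fst v"
  using charts semi_riem_N atlas_v by unfold_locales (auto simp: is_chart_def)

text \<open>The tangent vector \<open>f\<^sub>*(\<partial>\<^sub>i)\<close>, the image of the \<open>i\<close>-th coordinate field of \<open>u\<close>.\<close>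

definition E :: "'a \<Rightarrow> 'n \<Rightarrow> real^'m" where
  "E q i = column i (differential f u v q)"

text \<open>The connection matrix: the Levi-Civita connection of \<open>N\<close>, pulled back along \<open>f\<close>, is the flat
  derivative of components plus this matrix. Treating it as a matrix reduces most index
  computations to matrix algebra.\<close>

definition conn :: "'n \<Rightarrow> 'a \<Rightarrow> real^'m^'m" where
  "conn i q = (\<chi> a d. \<Sum>b\<in>UNIV. amb.\<Gamma> (f q) a b d * E q i $ b)"

definition cov_along :: "'n \<Rightarrow> ('a \<Rightarrow> real^'m) \<Rightarrow> 'a \<Rightarrow> real^'m" where
  "cov_along i V q = dom.vec_pd i V q + conn i q *v V q"

definition amb_prod :: "'a \<Rightarrow> real^'m \<Rightarrow> real^'m \<Rightarrow> real" where
  "amb_prod q X Y = X \<bullet> (amb.g (f q) *v Y)"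

lemma E_component: "E q i $ a = chart_pd u i (\<lambda>r. snd v (f r) $ a) q"
  by (simp add: E_def column_def differential_def)

lemma map_smooth: "dom.chart_smooth (\<lambda>r. snd v (f r) $ a)"
  using immersion atlas_u atlas_v
  by (simp add: isometric_immersion_def smooth_map_def dom.chart_smooth_def chart_image_def)

lemma E_smooth: "dom.chart_smooth (\<lambda>r. E r i $ a)"
  unfolding E_component by (rule dom.chart_smooth_pd[OF map_smooth])

lemma E_diff: "q \<in> W \<Longrightarrow> dom.vec_diff (\<lambda>r. E r i) q"
  by (simp add: dom.vec_diff_def dom.chart_smooth_diff[OF E_smooth])

lemma
  assumes q: "q \<in> W" and K: "chart_diff v K (f q)"
  shows chart_diff_pullback: "chart_diff u (\<lambda>r. K (f r)) q"
    and chart_pd_pullback: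
      "chart_pd u i (\<lambda>r. K (f r)) q = (\<Sum>b\<in>UNIV. chart_pd v b K (f q) * E q i $ b)"
proof -
  let ?F = "\<lambda>x. snd v (f (inv_into (fst u) (snd u) x))"
  have F: "(\<lambda>x. ?F x $ a) differentiable at (snd u q)" for a
    using dom.chart_smooth_diff[OF map_smooth q] by (simp add: chart_diff_def coord_rep_eq)
  then have F: "?F differentiable at (snd u q)"
    by (subst differentiable_componentwise_within) (auto simp: Basis_vec_def inner_axis)
  have Fq: "?F (snd u q) = snd v (f q)"
    by (simp add: dom.inv_chart[OF q])
  have rep: "coord_rep u (\<lambda>r. K (f r)) x = coord_rep v K (?F x)" if "x \<in> snd u ` W" for x
    using that by (auto simp: dom.coord_rep_chart amb.coord_rep_chart dom.inv_chart)
  have x: "snd u q \<in> snd u ` W"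
    using q by blast
  have K': "coord_rep v K differentiable at (?F (snd u q))"
    using K by (simp add: chart_diff_def Fq)
  have transfer_diff: "coord_rep u (\<lambda>r. K (f r)) differentiable at (snd u q) \<longleftrightarrow>
      (\<lambda>x. coord_rep v K (?F x)) differentiable at (snd u q)"
    by (rule partial_deriv_cong_open(1)[OF dom.open_chart_image x]) (rule rep)
  have transfer_pd: "partial_deriv i (coord_rep u (\<lambda>r. K (f r))) (snd u q) =
      partial_deriv i (\<lambda>x. coord_rep v K (?F x)) (snd u q)"
    by (rule partial_deriv_cong_open(2)[OF dom.open_chart_image x]) (rule rep)
  have "(\<lambda>x. coord_rep v K (?F x)) differentiable at (snd u q)"
    using differentiable_chain_at[OF F K'] unfolding o_def .
  then show "chart_diff u (\<lambda>r. K (f r)) q"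
    unfolding chart_diff_def by (rule transfer_diff[THEN iffD2])
  show "chart_pd u i (\<lambda>r. K (f r)) q = (\<Sum>b\<in>UNIV. chart_pd v b K (f q) * E q i $ b)"
    unfolding E_component chart_pd_def[of u i] transfer_pd partial_deriv_chain[OF F K']
    by (simp add: Fq chart_pd_def coord_rep_eq)
qed

lemma christoffel_along_diff: "q \<in> W \<Longrightarrow> chart_diff u (\<lambda>r. amb.\<Gamma> (f r) a b d) q"
  by (rule chart_diff_pullback) (auto intro: amb.christoffel_diff)

lemma metric_along_diff: "q \<in> W \<Longrightarrow> dom.mat_diff (\<lambda>r. amb.g (f r)) q"
  unfolding dom.mat_diff_def by (intro allI chart_diff_pullback) (auto intro: amb.metric_diff)

lemma conn_diff: "q \<in> W \<Longrightarrow> dom.mat_diff (conn i) q"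
  unfolding dom.mat_diff_def conn_def using dom.chart_smooth_diff[OF E_smooth]
  by (auto intro!: chart_diff_intros christoffel_along_diff)

lemma amb_prod_add_left: "amb_prod q (X + Y) Z = amb_prod q X Z + amb_prod q Y Z"
  by (simp add: amb_prod_def inner_add_left)

lemma amb_prod_diff_left: "amb_prod q (X - Y) Z = amb_prod q X Z - amb_prod q Y Z"
  by (simp add: amb_prod_def inner_diff_left)

lemma amb_prod_scaleR_left: "amb_prod q (k *\<^sub>R X) Z = k * amb_prod q X Z"
  by (simp add: amb_prod_def)

lemma amb_prod_sum_left: "amb_prod q (\<Sum>l\<in>I. X l) Z = (\<Sum>l\<in>I. amb_prod q (X l) Z)"
  by (simp add: amb_prod_def inner_sum_left)

lemma amb_prod_expand: "amb_prod q X Y = (\<Sum>a\<in>UNIV. \<Sum>b\<in>UNIV. X $ a * amb.g (f q) $ a $ b * Y $ b)"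
  by (simp add: amb_prod_def inner_vec_def matrix_vector_mult_def sum_distrib_left mult_ac)

lemma amb_prod_sym: "q \<in> W \<Longrightarrow> amb_prod q X Y = amb_prod q Y X"
  unfolding amb_prod_expand by (subst sum.swap) (simp add: amb.metric_sym mult_ac)

lemma amb_prod_E: "q \<in> W \<Longrightarrow> amb_prod q (E q i) (E q j) = dom.g q $ i $ j"
proof -
  assume q: "q \<in> W"
  then have "dom.g q = transpose (differential f u v q) ** amb.g (f q) ** differential f u v q"
    using immersion dom.in_charts_at[OF q] amb.in_charts_at[of "f q"]
    unfolding isometric_immersion_def by blast
  then have "dom.g q $ i $ j = (\<Sum>b\<in>UNIV. \<Sum>a\<in>UNIV. E q i $ a * amb.g (f q) $ a $ b * E q j $ b)"
    by (simp add: matrix_matrix_mult_def transpose_def E_def column_def sum_distrib_right)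
  then show ?thesis
    unfolding amb_prod_expand by (subst sum.swap) simp
qed

lemma cov_along_add:
  "dom.vec_diff V q \<Longrightarrow> dom.vec_diff V' q \<Longrightarrow>
    cov_along i (\<lambda>r. V r + V' r) q = cov_along i V q + cov_along i V' q"
  by (simp add: cov_along_def dom.vec_pd_add matrix_vector_right_distrib)

lemma cov_along_sum_scaleR:
  fixes K :: "'k::finite \<Rightarrow> 'a \<Rightarrow> real"
  assumes "q \<in> W" "\<And>l. chart_diff u (K l) q" "\<And>l. dom.vec_diff (V l) q"
  shows "cov_along i (\<lambda>r. \<Sum>l\<in>UNIV. K l r *\<^sub>R V l r) q =
    (\<Sum>l\<in>UNIV. chart_pd u i (K l) q *\<^sub>R V l q + K l q *\<^sub>R cov_along i (V l) q)"
  using assms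
  by (simp add: cov_along_def dom.vec_pd_sum dom.vec_pd_scaleR dom.vec_diff_scaleR
      linear_sum[OF matrix_vector_mul_linear] matrix_vector_mult_scaleR sum.distrib scaleR_add_right)

text \<open>Metric compatibility of \<open>N\<close> combined with the chain rule, with the sums over indices
  collected into connection matrices.\<close>

lemma mat_pd_metric_along:
  assumes q: "q \<in> W"
  shows "dom.mat_pd i (\<lambda>r. amb.g (f r)) q = transpose (conn i q) ** amb.g (f q) + amb.g (f q) ** conn i q"
proof -
  have fq: "f q \<in> fst v"
    using q by simp
  have "chart_pd u i (\<lambda>r. amb.g (f r) $ a $ b) q =
      (\<Sum>k\<in>UNIV. conn i q $ k $ a * amb.g (f q) $ k $ b) + (\<Sum>k\<in>UNIV. amb.g (f q) $ a $ k * conn i q $ k $ b)"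
    for a b
  proof -
    have *: "(\<Sum>d\<in>UNIV. (\<Sum>k\<in>UNIV. amb.\<Gamma> (f q) k d a' * amb.g (f q) $ k $ b') * E q i $ d) =
        (\<Sum>k\<in>UNIV. conn i q $ k $ a' * amb.g (f q) $ k $ b')" for a' b'
      unfolding sum_distrib_right conn_def by (subst sum.swap) (simp add: sum_distrib_left sum_distrib_right mult_ac)
    show ?thesis
      unfolding chart_pd_pullback[OF q amb.metric_diff[OF fq]] amb.metric_compatible[OF fq]
        distrib_right sum.distrib *
      by (simp add: amb.metric_sym[OF fq, of a] mult.commute)
  qed
  then show ?thesis
    by (simp add: dom.mat_pd_def matrix_matrix_mult_def transpose_def vec_eq_iff)
qed

text \<open>The product rule for the flat derivative produces the derivative of the metric as its middle
  term; by \<open>mat_pd_metric_along\<close> that term is precisely what completes both flat derivatives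
  to covariant ones.\<close>

lemma chart_pd_amb_prod:
  assumes q: "q \<in> W" and V: "dom.vec_diff V q" "dom.vec_diff V' q"
  shows "chart_pd u i (\<lambda>r. amb_prod r (V r) (V' r)) q =
    amb_prod q (cov_along i V q) (V' q) + amb_prod q (V q) (cov_along i V' q)"
proof -
  have adj: "X \<bullet> (Y v* A) = (A *v X) \<bullet> Y" for A :: "real^'m^'m" and X Y
    by (metis dot_lmul_matrix inner_commute)
  show ?thesis
    unfolding amb_prod_def
    unfolding dom.chart_pd_inner[OF q V(1) dom.vec_diff_matrix_vector[OF metric_along_diff[OF q] V(2)]]
      dom.vec_pd_matrix_vector[OF q metric_along_diff[OF q] V(2)] mat_pd_metric_along[OF q]
    by (simp add: cov_along_def inner_add_left inner_add_right
        matrix_vector_right_distrib matrix_vector_mult_add_rdistrib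
        adj flip: matrix_vector_mul_assoc)
qed

end

context immersed_patch
begin

section \<open>Curvature along the immersion\<close>

text \<open>Both sides are second partial derivatives of one component of the immersion.\<close>

lemma E_pd_sym: "q \<in> W \<Longrightarrow> chart_pd u i (\<lambda>r. E r j $ a) q = chart_pd u j (\<lambda>r. E r i $ a) q"
  unfolding E_component by (rule dom.chart_pd_commute[OF map_smooth])

text \<open>The curvature of the pulled-back connection, in the form \<open>d\<omega> + \<omega> \<and> \<omega>\<close>.\<close>

definition conn_curv :: "'n \<Rightarrow> 'n \<Rightarrow> 'a \<Rightarrow> real^'m^'m" where
  "conn_curv i j q = dom.mat_pd i (conn j) q - dom.mat_pd j (conn i) q + conn i q ** conn j q - conn j q ** conn i q"

text \<open>Expanding both second covariant derivatives, the second flat derivatives of \<open>V\<close> agree and the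
  terms with one flat derivative of \<open>V\<close> are symmetric in \<open>i\<close> and \<open>j\<close>; only the curvature matrix
  is left.\<close>

lemma cov_along_commutator:
  assumes q: "q \<in> W" and V: "\<And>a. dom.chart_smooth (\<lambda>r. V r $ a)"
  shows "cov_along i (cov_along j V) q - cov_along j (cov_along i V) q = conn_curv i j q *v V q"
proof -
  have V1: "dom.vec_diff V q"
    using V q by (simp add: dom.vec_diff_def dom.chart_smooth_diff)
  have V2: "dom.vec_diff (dom.vec_pd k V) q" for k
    unfolding dom.vec_diff_def dom.vec_pd_def
    using dom.chart_smooth_diff[OF dom.chart_smooth_pd[OF V] q] by simp
  have sym: "dom.vec_pd i (dom.vec_pd j V) q = dom.vec_pd j (dom.vec_pd i V) q"
    unfolding dom.vec_pd_def using dom.chart_pd_commute[OF V q] by simp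
  have second: "cov_along k (cov_along l V) q =
      dom.vec_pd k (dom.vec_pd l V) q + (dom.mat_pd k (conn l) q *v V q + conn l q *v dom.vec_pd k V q)
      + (conn k q *v dom.vec_pd l V q + (conn k q ** conn l q) *v V q)" for k l
    unfolding cov_along_def
    by (simp only: dom.vec_pd_add V1 V2 dom.vec_diff_matrix_vector[OF conn_diff[OF q] V1]
        dom.vec_pd_matrix_vector[OF q conn_diff[OF q] V1] matrix_vector_right_distrib
        matrix_vector_mul_assoc)
  show ?thesis
    unfolding second sym conn_curv_def
    by (simp add: matrix_vector_mult_add_rdistrib matrix_vector_mult_diff_rdistrib)
qed

text \<open>The curvature of a pulled-back connection is the pulled-back curvature. Differentiating the
  connection matrix gives, besides derivatives of the Christoffel symbols of \<open>N\<close>, second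
  derivatives of the immersion; these are symmetric by \<open>E_pd_sym\<close> and drop out of the
  antisymmetrisation.\<close>

lemma conn_curv_component:
  assumes q: "q \<in> W"
  shows "conn_curv i j q $ a $ e =
    (\<Sum>b\<in>UNIV. \<Sum>d\<in>UNIV. E q i $ b * E q j $ d * curvature_op N v (f q) b d e a)"
proof -
  let ?G = "\<lambda>a b d. amb.\<Gamma> (f q) a b d"
  have fq: "f q \<in> fst v"
    using q by simp
  have pd: "chart_pd u k (\<lambda>r. conn l r $ a $ e) q =
      (\<Sum>b\<in>UNIV. \<Sum>d\<in>UNIV. E q k $ b * E q l $ d * chart_pd v b (\<lambda>y. amb.\<Gamma> y a d e) (f q))
      + (\<Sum>d\<in>UNIV. ?G a d e * chart_pd u k (\<lambda>r. E r l $ d) q)" for k l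
  proof -
    have "chart_pd u k (\<lambda>r. conn l r $ a $ e) q =
      (\<Sum>d\<in>UNIV. (\<Sum>b\<in>UNIV. chart_pd v b (\<lambda>y. amb.\<Gamma> y a d e) (f q) * E q k $ b) * E q l $ d
         + ?G a d e * chart_pd u k (\<lambda>r. E r l $ d) q)"
      using dom.chart_smooth_diff[OF E_smooth q] christoffel_along_diff[OF q]
      by (simp add: conn_def chart_pd_sum chart_diff_mult dom.chart_pd_mult[OF q]
          chart_pd_pullback[OF q amb.christoffel_diff[OF fq]])
    also have "\<dots> = (\<Sum>d\<in>UNIV. \<Sum>b\<in>UNIV. E q k $ b * E q l $ d * chart_pd v b (\<lambda>y. amb.\<Gamma> y a d e) (f q))
      + (\<Sum>d\<in>UNIV. ?G a d e * chart_pd u k (\<lambda>r. E r l $ d) q)"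
      by (simp add: sum.distrib sum_distrib_left sum_distrib_right mult_ac)
    finally show ?thesis
      by (subst (asm) sum.swap)
  qed
  have pr: "(conn k q ** conn l q) $ a $ e =
      (\<Sum>b\<in>UNIV. \<Sum>d\<in>UNIV. \<Sum>m\<in>UNIV. E q k $ b * E q l $ d * (?G m d e * ?G a b m))" for k l
  proof -
    have "(conn k q ** conn l q) $ a $ e =
        (\<Sum>m\<in>UNIV. \<Sum>b\<in>UNIV. \<Sum>d\<in>UNIV. E q k $ b * E q l $ d * (?G m d e * ?G a b m))"
      by (simp add: matrix_matrix_mult_def conn_def sum_product mult_ac)
    also have "\<dots> = (\<Sum>b\<in>UNIV. \<Sum>m\<in>UNIV. \<Sum>d\<in>UNIV. E q k $ b * E q l $ d * (?G m d e * ?G a b m))"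
      by (rule sum.swap)
    also have "\<dots> = (\<Sum>b\<in>UNIV. \<Sum>d\<in>UNIV. \<Sum>m\<in>UNIV. E q k $ b * E q l $ d * (?G m d e * ?G a b m))"
      by (intro sum.cong refl sum.swap)
    finally show ?thesis .
  qed
  \<comment> \<open>Renaming summation indices brings the terms with \<open>i\<close> and \<open>j\<close> exchanged to a common prefactor.\<close>
  have sw: "(\<Sum>b\<in>UNIV. \<Sum>d\<in>UNIV. E q j $ b * E q i $ d * X b d) = (\<Sum>b\<in>UNIV. \<Sum>d\<in>UNIV. E q i $ b * E q j $ d * X d b)" for X
    by (subst sum.swap) (simp add: mult_ac)
  have "conn_curv i j q $ a $ e =
    (\<Sum>b\<in>UNIV. \<Sum>d\<in>UNIV. E q i $ b * E q j $ d * chart_pd v b (\<lambda>y. amb.\<Gamma> y a d e) (f q))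
    - (\<Sum>b\<in>UNIV. \<Sum>d\<in>UNIV. E q i $ b * E q j $ d * chart_pd v d (\<lambda>y. amb.\<Gamma> y a b e) (f q))
    + (\<Sum>b\<in>UNIV. \<Sum>d\<in>UNIV. E q i $ b * E q j $ d * (\<Sum>m\<in>UNIV. ?G m d e * ?G a b m))
    - (\<Sum>b\<in>UNIV. \<Sum>d\<in>UNIV. E q i $ b * E q j $ d * (\<Sum>m\<in>UNIV. ?G m b e * ?G a d m))"
    unfolding conn_curv_def vector_add_component vector_minus_component pr dom.mat_pd_def vec_lambda_beta pd
      E_pd_sym[OF q, of j i]
    by (simp add: sw[of "\<lambda>b d. chart_pd v b (\<lambda>y. amb.\<Gamma> y a d e) (f q)"] sw[of "\<lambda>b d. \<Sum>m\<in>UNIV. ?G m d e * ?G a b m"]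
        flip: sum_distrib_left)
  also have "\<dots> = (\<Sum>b\<in>UNIV. \<Sum>d\<in>UNIV. E q i $ b * E q j $ d * curvature_op N v (f q) b d e a)"
    by (simp add: curvature_op_def sum.distrib sum_subtractf algebra_simps)
  finally show ?thesis .
qed

lemma amb_prod_conn_curv:
  assumes q: "q \<in> W"
  shows "amb_prod q (conn_curv i j q *v E q k) (E q s) =
    (\<Sum>b\<in>UNIV. \<Sum>d\<in>UNIV. \<Sum>e\<in>UNIV. \<Sum>l\<in>UNIV.
      E q i $ b * E q j $ d * E q k $ e * E q s $ l * riemann N v (f q) b d e l)"
proof -
  let ?R = "curvature_op N v (f q)" and ?g = "amb.g (f q)"
  have "amb_prod q (conn_curv i j q *v E q k) (E q s) =
    (\<Sum>a\<in>UNIV. \<Sum>l\<in>UNIV. \<Sum>e\<in>UNIV. \<Sum>b\<in>UNIV. \<Sum>d\<in>UNIV.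
      E q i $ b * E q j $ d * E q k $ e * E q s $ l * (?R b d e a * ?g $ a $ l))"
    by (simp add: amb_prod_expand matrix_vector_mult_def conn_curv_component[OF q]
        sum_distrib_left sum_distrib_right mult_ac)
  also have "\<dots> = (\<Sum>(a, l, e, b, d)\<in>UNIV.
      E q i $ b * E q j $ d * E q k $ e * E q s $ l * (?R b d e a * ?g $ a $ l))"
    by (simp add: sum.cartesian_product)
  also have "\<dots> = (\<Sum>(b, d, e, l, a)\<in>UNIV.
      E q i $ b * E q j $ d * E q k $ e * E q s $ l * (?R b d e a * ?g $ a $ l))"
    by (rule sum.reindex_bij_witness[of _ "\<lambda>(b, d, e, l, a). (a, l, e, b, d)" "\<lambda>(a, l, e, b, d). (b, d, e, l, a)"])
      auto
  also have "\<dots> = (\<Sum>b\<in>UNIV. \<Sum>d\<in>UNIV. \<Sum>e\<in>UNIV. \<Sum>l\<in>UNIV. \<Sum>a\<in>UNIV.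
      E q i $ b * E q j $ d * E q k $ e * E q s $ l * (?R b d e a * ?g $ a $ l))"
    by (simp add: sum.cartesian_product)
  finally show ?thesis
    by (simp add: riemann_def sum_distrib_left)
qed

section \<open>The Gauss equation\<close>

text \<open>The covariant derivative of one coordinate field along another; its normal component is the
  second fundamental form.\<close>

definition hess :: "'n \<Rightarrow> 'n \<Rightarrow> 'a \<Rightarrow> real^'m" where
  "hess i j q = cov_along i (\<lambda>r. E r j) q"

lemma conn_E:
  "(conn i q *v E q j) $ a = (\<Sum>b\<in>UNIV. \<Sum>d\<in>UNIV. amb.\<Gamma> (f q) a b d * E q i $ b * E q j $ d)"
  unfolding conn_def matrix_vector_mult_def vec_lambda_beta sum_distrib_right by (rule sum.swap)

lemma hess_eq: "hess i j q = hessian_along N f u v q i j"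
  unfolding hess_def hessian_along_def cov_along_def dom.vec_pd_def
  by (simp add: vec_eq_iff conn_E) (simp add: E_def column_def)

lemma hess_sym: "q \<in> W \<Longrightarrow> hess i j q = hess j i q"
proof -
  assume q: "q \<in> W"
  then have fq: "f q \<in> fst v" by simp
  have "(conn i q *v E q j) $ a = (conn j q *v E q i) $ a" for a
    unfolding conn_E by (subst sum.swap) (simp add: amb.christoffel_sym[OF fq] mult_ac)
  then show ?thesis
    unfolding hess_def cov_along_def dom.vec_pd_def using E_pd_sym[OF q] by (simp add: vec_eq_iff)
qed

lemma hess_diff: "q \<in> W \<Longrightarrow> dom.vec_diff (hess i j) q"
  unfolding hess_def[abs_def] cov_along_def
  using dom.chart_smooth_diff[OF dom.chart_smooth_pd[OF E_smooth]]
  by (intro dom.vec_diff_add dom.vec_diff_matrix_vector conn_diff E_diff)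
    (auto simp: dom.vec_diff_def dom.vec_pd_def)

text \<open>The Koszul argument: the derivatives of the induced metric are sums of such products, and by
  the symmetry of \<open>hess\<close> the combination of the first kind isolates a single one of them. So the
  tangential part of the ambient derivative is the Levi-Civita connection of \<open>M\<close>.\<close>

lemma amb_prod_hess:
  assumes q: "q \<in> W"
  shows "amb_prod q (hess i j q) (E q m) = (\<Sum>k\<in>UNIV. dom.\<Gamma> q k i j * dom.g q $ k $ m)"
proof -
  have pd: "chart_pd u k (\<lambda>r. dom.g r $ l $ o') q =
      amb_prod q (hess k l q) (E q o') + amb_prod q (hess k o' q) (E q l)" for k l o'
  proof -
    have "chart_pd u k (\<lambda>r. dom.g r $ l $ o') q = chart_pd u k (\<lambda>r. amb_prod r (E r l) (E r o')) q"
      by (rule dom.chart_pd_cong[OF q]) (simp add: amb_prod_E)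
    then show ?thesis
      unfolding chart_pd_amb_prod[OF q E_diff[OF q] E_diff[OF q]] hess_def
      by (simp only: amb_prod_sym[OF q, of "E q l"])
  qed
  show ?thesis
    unfolding dom.christoffel_lower[OF q] pd
    using hess_sym[OF q, of m i] hess_sym[OF q, of m j] hess_sym[OF q, of i j] by simp
qed

text \<open>The normal part in the Gauss formula. It is vector-valued and is a differentiable field on all
  of the patch, whereas a unit normal field need not even be continuous; this is why the Gauss
  equation is first proved for \<open>sff\<close> and a unit normal vector enters only at a single point.\<close>

definition sff :: "'n \<Rightarrow> 'n \<Rightarrow> 'a \<Rightarrow> real^'m" where
  "sff i j q = hess i j q - (\<Sum>l\<in>UNIV. dom.\<Gamma> q l i j *\<^sub>R E q l)"

lemma sff_normal: "q \<in> W \<Longrightarrow> amb_prod q (sff i j q) (E q m) = 0"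
  by (simp add: sff_def amb_prod_diff_left amb_prod_sum_left amb_prod_scaleR_left amb_prod_E amb_prod_hess)

lemma sff_diff: "q \<in> W \<Longrightarrow> dom.vec_diff (sff i j) q"
  unfolding sff_def[abs_def]
  by (intro dom.vec_diff_diff hess_diff dom.vec_diff_sum dom.vec_diff_scaleR E_diff dom.christoffel_diff) auto

text \<open>The commutator of the ambient covariant derivatives of a coordinate field is computed twice: as
  the ambient curvature, and from the splitting into a tangential part and \<open>sff\<close>. In the second
  computation the tangential terms give the curvature of \<open>M\<close>, and the products of \<open>sff\<close> come
  from differentiating its orthogonality to the coordinate fields.\<close>

lemma Gauss_equation:
  assumes q: "q \<in> W"
  shows "riemann M u q i j k s = amb_prod q (conn_curv i j q *v E q k) (E q s)
    + amb_prod q (sff j k q) (sff i s q) - amb_prod q (sff i k q) (sff j s q)"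
proof -
  \<comment> \<open>The Weingarten relation, from the derivative of \<open>amb_prod r (sff j k r) (E r s) = 0\<close>.\<close>
  have normal: "amb_prod q (cov_along i (sff j k) q) (E q s) = - amb_prod q (sff j k q) (sff i s q)" for i j k s
  proof -
    have "0 = chart_pd u i (\<lambda>r. amb_prod r (sff j k r) (E r s)) q"
      using dom.chart_pd_cong[OF q, of "\<lambda>r. amb_prod r (sff j k r) (E r s)" "\<lambda>_. 0" i] sff_normal
      by (simp add: chart_pd_const)
    also have "\<dots> = amb_prod q (cov_along i (sff j k) q) (E q s) + amb_prod q (hess i s q) (sff j k q)"
      unfolding chart_pd_amb_prod[OF q sff_diff[OF q] E_diff[OF q]] hess_def
      by (simp only: amb_prod_sym[OF q, of "sff j k q"])
    also have "hess i s q = (\<Sum>l\<in>UNIV. dom.\<Gamma> q l i s *\<^sub>R E q l) + sff i s q"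
      by (simp add: sff_def)
    also have "amb_prod q \<dots> (sff j k q) = amb_prod q (sff j k q) (sff i s q)"
      using sff_normal[OF q] amb_prod_sym[OF q]
      by (simp add: amb_prod_add_left amb_prod_sum_left amb_prod_scaleR_left)
    finally show ?thesis by simp
  qed
  have second: "amb_prod q (cov_along i (cov_along j (\<lambda>r. E r k)) q) (E q s) =
      (\<Sum>l\<in>UNIV. chart_pd u i (\<lambda>r. dom.\<Gamma> r l j k) q * dom.g q $ l $ s)
      + (\<Sum>l\<in>UNIV. (\<Sum>m\<in>UNIV. dom.\<Gamma> q m j k * dom.\<Gamma> q l i m) * dom.g q $ l $ s)
      - amb_prod q (sff j k q) (sff i s q)" for i j k s
  proof -
    have "cov_along j (\<lambda>r. E r k) = (\<lambda>r. (\<Sum>l\<in>UNIV. dom.\<Gamma> r l j k *\<^sub>R E r l) + sff j k r)"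
      by (simp add: sff_def hess_def fun_eq_iff)
    then have "cov_along i (cov_along j (\<lambda>r. E r k)) q =
        (\<Sum>l\<in>UNIV. chart_pd u i (\<lambda>r. dom.\<Gamma> r l j k) q *\<^sub>R E q l + dom.\<Gamma> q l j k *\<^sub>R hess i l q)
        + cov_along i (sff j k) q"
      using q
      by (simp add: cov_along_add cov_along_sum_scaleR[of q] sff_diff E_diff dom.christoffel_diff
          dom.vec_diff_sum dom.vec_diff_scaleR hess_def)
    moreover have "(\<Sum>l\<in>UNIV. dom.\<Gamma> q l j k * (\<Sum>m\<in>UNIV. dom.\<Gamma> q m i l * dom.g q $ m $ s)) =
        (\<Sum>l\<in>UNIV. (\<Sum>m\<in>UNIV. dom.\<Gamma> q m j k * dom.\<Gamma> q l i m) * dom.g q $ l $ s)"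
      unfolding sum_distrib_left sum_distrib_right by (subst sum.swap) (simp add: mult_ac)
    ultimately show ?thesis
      by (simp add: amb_prod_add_left amb_prod_sum_left amb_prod_scaleR_left amb_prod_E[OF q]
          amb_prod_hess[OF q] normal sum.distrib)
  qed
  have "amb_prod q (conn_curv i j q *v E q k) (E q s) =
      amb_prod q (cov_along i (cov_along j (\<lambda>r. E r k)) q) (E q s)
      - amb_prod q (cov_along j (cov_along i (\<lambda>r. E r k)) q) (E q s)"
    by (simp add: cov_along_commutator[OF q E_smooth, symmetric] amb_prod_diff_left)
  then show ?thesis
    unfolding second riemann_def curvature_op_def
    by (simp add: algebra_simps sum.distrib sum_subtractf)
qed

end

section \<open>Codimension one\<close>

text \<open>The columns of \<open>D\<close> span a space of dimension \<open>n\<close>, and \<open>\<xi>\<close> lies outside it because it is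
  orthogonal to that space but not to itself; so together they span everything. Therefore
  subtracting from \<open>X\<close> its component along \<open>\<xi>\<close> leaves a vector orthogonal to all vectors.\<close>

lemma normal_space_one_dimensional:
  fixes D :: "real^'n::finite^'m::finite" and G :: "real^'m^'m" and \<xi> X Y :: "real^'m"
  assumes card: "CARD('m) = CARD('n) + 1" and inj: "inj ((*v) D)"
    and \<xi>: "\<And>i. column i D \<bullet> (G *v \<xi>) = 0" "\<xi> \<bullet> (G *v \<xi>) = \<epsilon>" "\<epsilon> = 1 \<or> \<epsilon> = -1"
    and X: "\<And>i. column i D \<bullet> (G *v X) = 0"
  shows "Y \<bullet> (G *v X) = \<epsilon> * (\<xi> \<bullet> (G *v X)) * (Y \<bullet> (G *v \<xi>))"
proof -
  define w where "w = X - (\<epsilon> * (\<xi> \<bullet> (G *v X))) *\<^sub>R \<xi>"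
  let ?S = "range ((*v) D)"
  have range: "z \<bullet> y = 0" if "z \<in> ?S" "\<And>i. column i D \<bullet> y = 0" for y z
    using that by (auto simp: matrix_mult_sum inner_sum_left scalar_mult_eq_scaleR)
  have sub: "subspace ?S"
    by (simp add: linear_subspace_image)
  have "dim ?S = DIM(real^'n)"
    using dim_image_eq[of "(*v) D" UNIV] inj by simp
  moreover have "\<xi> \<notin> span ?S"
    using range[of \<xi> "G *v \<xi>"] \<xi> sub by (auto simp: span_eq_iff[THEN iffD2])
  ultimately have "dim (insert \<xi> ?S) = DIM(real^'m)"
    using card by (simp add: dim_insert)
  then have full: "span (insert \<xi> ?S) = UNIV"
    using dim_eq_full by blast
  have Gw: "G *v w = G *v X - (\<epsilon> * (\<xi> \<bullet> (G *v X))) *\<^sub>R (G *v \<xi>)"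
    by (simp add: w_def matrix_vector_mult_diff_distrib matrix_vector_mult_scaleR)
  have "column i D \<bullet> (G *v w) = 0" for i
    by (simp add: Gw inner_diff_right \<xi>(1) X)
  moreover have "\<xi> \<bullet> (G *v w) = 0"
    using \<xi>(3) by (auto simp: Gw inner_diff_right \<xi>(2))
  ultimately have "z \<bullet> (G *v w) = 0" if "z \<in> insert \<xi> ?S" for z
    using that range by auto
  then have "orthogonal (G *v w) Y"
    by (intro orthogonal_to_span[of Y "insert \<xi> ?S"]) (auto simp: full orthogonal_def inner_commute)
  then have "Y \<bullet> (G *v w) = 0"
    by (simp add: orthogonal_def inner_commute)
  then show ?thesis
    by (simp add: Gw inner_diff_right)
qed

context immersed_patch
begin

text \<open>For an ambient space of constant curvature, inserting tangent vectors into the curvature tensor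
  turns the ambient metric into the induced one. The fourfold sum factorises once the two inner
  sums are recognised as lowered components of the tangent vectors.\<close>

lemma amb_prod_conn_curv_constant:
  assumes q: "q \<in> W"
    and R: "\<And>h i j k. riemann N v (f q) h i j k =
      c * (amb.g (f q) $ h $ k * amb.g (f q) $ i $ j - amb.g (f q) $ h $ j * amb.g (f q) $ i $ k)"
  shows "amb_prod q (conn_curv i j q *v E q k) (E q s) =
    c * (dom.g q $ i $ s * dom.g q $ j $ k - dom.g q $ i $ k * dom.g q $ j $ s)"
proof -
  let ?G = "amb.g (f q)" and ?L = "\<lambda>i b. (amb.g (f q) *v E q i) $ b"
  have prod: "(\<Sum>b\<in>UNIV. \<Sum>d\<in>UNIV. E q i $ b * E q j $ d * (?L k b * ?L s d)) =
      dom.g q $ i $ k * dom.g q $ j $ s" for i j k s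
    unfolding amb_prod_E[OF q, symmetric] amb_prod_def inner_vec_def sum_product
    by (simp add: mult_ac)
  have inner: "(\<Sum>e\<in>UNIV. \<Sum>l\<in>UNIV. E q k $ e * E q s $ l * (?G $ b $ l * ?G $ d $ e - ?G $ b $ e * ?G $ d $ l))
      = ?L s b * ?L k d - ?L k b * ?L s d" for b d
  proof -
    have "?L s b * ?L k d = (\<Sum>e\<in>UNIV. \<Sum>l\<in>UNIV. E q k $ e * E q s $ l * (?G $ b $ l * ?G $ d $ e))"
      by (simp add: matrix_vector_mult_def sum_product mult_ac)
    moreover have "?L k b * ?L s d = (\<Sum>e\<in>UNIV. \<Sum>l\<in>UNIV. E q k $ e * E q s $ l * (?G $ b $ e * ?G $ d $ l))"
      by (simp add: matrix_vector_mult_def sum_product mult_ac)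
    ultimately show ?thesis
      by (simp add: right_diff_distrib sum_subtractf)
  qed
  have "amb_prod q (conn_curv i j q *v E q k) (E q s) =
    (\<Sum>b\<in>UNIV. \<Sum>d\<in>UNIV. c * (E q i $ b * E q j $ d * (\<Sum>e\<in>UNIV. \<Sum>l\<in>UNIV.
      E q k $ e * E q s $ l * (?G $ b $ l * ?G $ d $ e - ?G $ b $ e * ?G $ d $ l))))"
    unfolding amb_prod_conn_curv[OF q] R sum_distrib_left by (simp only: mult_ac)
  also have "\<dots> = c * ((\<Sum>b\<in>UNIV. \<Sum>d\<in>UNIV. E q i $ b * E q j $ d * (?L s b * ?L k d))
      - (\<Sum>b\<in>UNIV. \<Sum>d\<in>UNIV. E q i $ b * E q j $ d * (?L k b * ?L s d)))"
    unfolding inner by (simp add: right_diff_distrib sum_subtractf sum_distrib_left)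
  finally show ?thesis
    unfolding prod .
qed

text \<open>In codimension one, each value of \<open>sff\<close> is a multiple of the unit normal vector, so products of
  its values reduce to products of components of \<open>H\<close>.\<close>

lemma Gauss_equation_hypersurface:
  assumes q: "q \<in> W" and card: "CARD('m) = CARD('n) + 1"
    and R: "\<And>h i j k. riemann N v (f q) h i j k =
      c * (amb.g (f q) $ h $ k * amb.g (f q) $ i $ j - amb.g (f q) $ h $ j * amb.g (f q) $ i $ k)"
    and \<xi>: "\<And>i. column i (differential f u v q) \<bullet> (amb.g (f q) *v \<xi>) = 0"
      "\<xi> \<bullet> (amb.g (f q) *v \<xi>) = \<epsilon>" "\<epsilon> = 1 \<or> \<epsilon> = -1"
    and H: "\<And>i j. H $ i $ j = hessian_along N f u v q i j \<bullet> (amb.g (f q) *v \<xi>)"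
  shows "riemann M u q h i j k = \<epsilon> * (H $ h $ k * H $ i $ j - H $ h $ j * H $ i $ k)
      + c * (dom.g q $ h $ k * dom.g q $ i $ j - dom.g q $ h $ j * dom.g q $ i $ k)"
    and "H $ i $ j = H $ j $ i"
proof -
  have inj: "inj ((*v) (differential f u v q))"
    using immersion dom.in_charts_at[OF q] amb.in_charts_at[of "f q"] q
    unfolding isometric_immersion_def by blast
  have sff: "amb_prod q (sff i j q) \<xi> = H $ i $ j" for i j
    using \<xi>(1) by (simp add: sff_def amb_prod_diff_left amb_prod_sum_left amb_prod_scaleR_left H hess_eq)
      (simp add: amb_prod_def E_def)
  have normal: "column l (differential f u v q) \<bullet> (amb.g (f q) *v sff i j q) = 0" for i j l
    using sff_normal[OF q, of i j l] amb_prod_sym[OF q, of _ "E q l"] by (simp add: amb_prod_def E_def)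
  have "amb_prod q (sff h k q) (sff i j q) = \<epsilon> * amb_prod q \<xi> (sff i j q) * amb_prod q (sff h k q) \<xi>" for h i j k
    unfolding amb_prod_def by (rule normal_space_one_dimensional[OF card inj \<xi> normal])
  then have "amb_prod q (sff h k q) (sff i j q) = \<epsilon> * (H $ h $ k * H $ i $ j)" for h i j k
    using sff amb_prod_sym[OF q, of \<xi>] by simp
  then show "riemann M u q h i j k = \<epsilon> * (H $ h $ k * H $ i $ j - H $ h $ j * H $ i $ k)
      + c * (dom.g q $ h $ k * dom.g q $ i $ j - dom.g q $ h $ j * dom.g q $ i $ k)"
    unfolding Gauss_equation[OF q] amb_prod_conn_curv_constant[OF q R] by (simp add: algebra_simps)
  show "H $ i $ j = H $ j $ i"
    unfolding H hess_eq[symmetric] by (simp add: hess_sym[OF q, of i j])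
qed

end

lemma (in metric_chart) ricci_eq_contraction:
  assumes q: "q \<in> W"
  shows "ricci M u q $ i $ j = (\<Sum>h\<in>UNIV. \<Sum>k\<in>UNIV. riemann M u q h i j k * matrix_inv (g q) $ k $ h)"
proof -
  have inv: "(\<Sum>k\<in>UNIV. g q $ l $ k * matrix_inv (g q) $ k $ h) = (if l = h then 1 else 0)" for l h
    using matrix_inv_works(1)[OF metric_invertible[OF q]]
    by (simp add: matrix_matrix_mult_def mat_def vec_eq_iff)
  have "(\<Sum>k\<in>UNIV. riemann M u q h i j k * matrix_inv (g q) $ k $ h) = curvature_op M u q h i j h" for h
  proof -
    have "(\<Sum>k\<in>UNIV. riemann M u q h i j k * matrix_inv (g q) $ k $ h) =
        (\<Sum>l\<in>UNIV. curvature_op M u q h i j l * (\<Sum>k\<in>UNIV. g q $ l $ k * matrix_inv (g q) $ k $ h))"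
      unfolding riemann_def sum_distrib_left sum_distrib_right by (subst sum.swap) (simp add: mult_ac)
    then show ?thesis
      by (simp add: inv if_distrib cong: if_cong)
  qed
  then show ?thesis
    by (simp add: ricci_def)
qed

text \<open>Contraction of the Gauss equation. The parts quadratic in \<open>H\<close> and in \<open>G\<close> have the same shape,
  and for \<open>G\<close> the trace is the dimension and the square is \<open>G\<close> itself.\<close>

lemma contraction_Gauss:
  fixes G H :: "real^'n^'n::finite"
  assumes inv: "invertible G" and sym: "\<And>i j. G $ i $ j = G $ j $ i" "\<And>i j. H $ i $ j = H $ j $ i"
    and R: "\<And>h i j k. R h i j k = \<epsilon> * (H $ h $ k * H $ i $ j - H $ h $ j * H $ i $ k)
      + c * (G $ h $ k * G $ i $ j - G $ h $ j * G $ i $ k)"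
  shows "(\<Sum>h\<in>UNIV. \<Sum>k\<in>UNIV. R h i j k * matrix_inv G $ k $ h) =
    \<epsilon> * (trace (matrix_inv G ** H) * H $ i $ j - (H ** matrix_inv G ** H) $ i $ j)
      + c * ((real CARD('n) - 1) * G $ i $ j)"
proof -
  let ?I = "matrix_inv G"
  have tr: "(\<Sum>h\<in>UNIV. \<Sum>k\<in>UNIV. T $ h $ k * ?I $ k $ h) = trace (?I ** T)" for T :: "real^'n^'n"
    unfolding trace_mul_sym[of ?I] by (simp add: trace_def matrix_matrix_mult_def)
  have pr: "(\<Sum>h\<in>UNIV. \<Sum>k\<in>UNIV. T $ h $ j * T $ i $ k * ?I $ k $ h) = (T ** ?I ** T) $ i $ j"
    for T :: "real^'n^'n"
    by (simp add: matrix_matrix_mult_def sum_distrib_left sum_distrib_right mult_ac)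
  have "(\<Sum>h\<in>UNIV. \<Sum>k\<in>UNIV. R h i j k * ?I $ k $ h) =
    \<epsilon> * ((\<Sum>h\<in>UNIV. \<Sum>k\<in>UNIV. H $ h $ k * ?I $ k $ h) * H $ i $ j
         - (\<Sum>h\<in>UNIV. \<Sum>k\<in>UNIV. H $ h $ j * H $ i $ k * ?I $ k $ h))
    + c * ((\<Sum>h\<in>UNIV. \<Sum>k\<in>UNIV. G $ h $ k * ?I $ k $ h) * G $ i $ j
         - (\<Sum>h\<in>UNIV. \<Sum>k\<in>UNIV. G $ h $ j * G $ i $ k * ?I $ k $ h))"
    unfolding R sum_distrib_left sum_distrib_right right_diff_distrib sum_subtractf[symmetric]
      sum.distrib[symmetric]
    by (intro sum.cong refl) (simp add: algebra_simps)
  then show ?thesis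
    unfolding tr pr by (simp add: matrix_inv_works[OF inv] trace_I left_diff_distrib)
qed

section \<open>Linear algebra of the associated operators\<close>

lemma matrix_scaleR_left: "(k *\<^sub>R A) ** B = k *\<^sub>R (A ** B)" for A :: "real^'n::finite^'m" and B :: "real^'k^'n"
  by (simp add: matrix_matrix_mult_def vec_eq_iff sum_distrib_left mult_ac)

lemma matrix_scaleR_right: "A ** (k *\<^sub>R B) = k *\<^sub>R (A ** B)" for A :: "real^'n::finite^'m" and B :: "real^'k^'n"
  by (simp add: matrix_matrix_mult_def vec_eq_iff sum_distrib_left mult_ac)

lemma matrix_add_right: "(A + B) ** C = A ** C + B ** C" for A :: "real^'n::finite^'m" and C :: "real^'k^'n"
  by (simp add: matrix_matrix_mult_def vec_eq_iff sum.distrib distrib_right)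

lemmas matrix_bilinear = matrix_scaleR_left matrix_scaleR_right matrix_add_right matrix_add_ldistrib

lemma matrix_cancel_left:
  fixes A :: "real^'n^'n::finite"
  assumes "invertible A" "A ** B = A ** C"
  shows "B = C"
  by (metis assms matrix_inv_works(2) matrix_mul_assoc matrix_mul_lid)

text \<open>Factoring \<open>G\<close> out turns the powers of a symmetric tensor into ordinary powers of its operator
  \<open>a\<close>, which is self-adjoint with respect to \<open>G\<close>. From here on, all statements about tensors
  become statements about polynomials in \<open>a\<close>.\<close>

lemma tensor_powers_operator:
  fixes G T :: "real^'n^'n::finite"
  assumes inv: "invertible G" and G: "transpose G = G" and T: "transpose T = T"
  defines "a \<equiv> assoc_operator G T"
  shows "T = G ** a" "matrix_tensor_power G T 2 = G ** (a ** a)"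
    "matrix_tensor_power G T 3 = G ** (a ** (a ** a))"
    "transpose (G ** (a ** a)) = G ** (a ** a)"
proof -
  show T_eq: "T = G ** a"
    by (simp add: a_def assoc_operator_def matrix_mul_assoc matrix_inv_works[OF inv])
  have "T = transpose a ** G"
    using T_eq T G by (metis matrix_transpose_mul)
  then have tr: "transpose a ** (G ** X) = G ** (a ** X)" for X
    using T_eq by (metis matrix_mul_assoc)
  show two: "matrix_tensor_power G T 2 = G ** (a ** a)"
    using tr[of a] by (simp add: numeral_2_eq_2 flip: a_def T_eq)
  show "matrix_tensor_power G T 3 = G ** (a ** (a ** a))"
    using two by (simp add: numeral_3_eq_3 numeral_2_eq_2 tr flip: a_def)
  have "transpose (transpose a ** T) = T ** a"
    by (simp add: matrix_transpose_mul T)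
  then show "transpose (G ** (a ** a)) = G ** (a ** a)"
    using tr[of a] T_eq by (metis matrix_mul_assoc)
qed

text \<open>The coefficients are those of the remainder of the squared quadratic polynomial modulo the
  cubic relation; the fourth power of \<open>a\<close> is eliminated by applying that relation twice.\<close>

lemma square_of_quadratic_operator:
  fixes a :: "real^'n^'n::finite"
  assumes cubic: "a ** (a ** a) = \<phi> *\<^sub>R (a ** a) + \<psi> *\<^sub>R a + \<rho> *\<^sub>R mat 1"
    and b: "b = x *\<^sub>R (a ** a) + y *\<^sub>R a + z *\<^sub>R mat 1"
  shows "b ** b = (x\<^sup>2 * (\<phi>\<^sup>2 + \<psi>) + 2 * x * y * \<phi> + y\<^sup>2 + 2 * x * z) *\<^sub>R (a ** a)
    + (x\<^sup>2 * (\<phi> * \<psi> + \<rho>) + 2 * x * y * \<psi> + 2 * y * z) *\<^sub>R a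
    + (x\<^sup>2 * \<phi> * \<rho> + 2 * x * y * \<rho> + z\<^sup>2) *\<^sub>R mat 1"
proof -
  have 3: "a ** a ** a = a ** (a ** a)" and 4: "a ** a ** (a ** a) = a ** (a ** (a ** a))"
    by (simp_all add: matrix_mul_assoc)
  have 5: "a ** (a ** (a ** a)) = \<phi> *\<^sub>R (a ** (a ** a)) + \<psi> *\<^sub>R (a ** a) + \<rho> *\<^sub>R a"
    unfolding cubic by (simp add: matrix_bilinear) (simp add: cubic)
  have "b ** b = x\<^sup>2 *\<^sub>R (a ** (a ** (a ** a))) + (2 * x * y) *\<^sub>R (a ** (a ** a))
    + (y\<^sup>2 + 2 * x * z) *\<^sub>R (a ** a) + (2 * y * z) *\<^sub>R a + z\<^sup>2 *\<^sub>R mat 1"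
    unfolding b by (simp add: matrix_bilinear 3 4) (simp add: vec_eq_iff power2_eq_square algebra_simps)
  then show ?thesis
    unfolding 5 unfolding cubic by (simp add: vec_eq_iff power2_eq_square algebra_simps)
qed

text \<open>If the square of \<open>a\<close> is not in the span of \<open>a\<close> and the identity, then all three are linearly
  independent: were \<open>a\<close> a multiple of the identity, its square would be one too.\<close>

lemma quadratic_operator_independent:
  fixes a :: "real^'n^'n::finite"
  assumes nolin: "\<nexists>\<alpha> \<beta>. a ** a = \<alpha> *\<^sub>R a + \<beta> *\<^sub>R mat 1"
    and eq: "x *\<^sub>R (a ** a) + y *\<^sub>R a + z *\<^sub>R mat 1 = x' *\<^sub>R (a ** a) + y' *\<^sub>R a + z' *\<^sub>R mat 1"
  shows "x = x'" "y = y'" "z = z'"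
proof -
  have *: "(x - x') *\<^sub>R (a ** a) = (y' - y) *\<^sub>R a + (z' - z) *\<^sub>R mat 1"
    using eq by (simp add: algebra_simps)
  show x: "x = x'"
  proof (rule ccontr)
    assume "x \<noteq> x'"
    then have "a ** a = inverse (x - x') *\<^sub>R ((x - x') *\<^sub>R (a ** a))"
      by simp
    also have "\<dots> = (inverse (x - x') * (y' - y)) *\<^sub>R a + (inverse (x - x') * (z' - z)) *\<^sub>R mat 1"
      unfolding * by (simp add: scaleR_add_right)
    finally show False using nolin by blast
  qed
  have **: "(y - y') *\<^sub>R a = (z' - z) *\<^sub>R mat 1"
    using * x by (simp add: algebra_simps)
  show y: "y = y'"
  proof (rule ccontr)
    assume "y \<noteq> y'"
    then have "a = inverse (y - y') *\<^sub>R ((y - y') *\<^sub>R a)"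
      by simp
    then obtain l where "a = l *\<^sub>R mat 1"
      unfolding ** by (auto simp: scaleR_scaleR)
    then have "a ** a = 0 *\<^sub>R a + (l * l) *\<^sub>R mat 1"
      by (simp add: matrix_bilinear)
    then show False using nolin by blast
  qed
  have "trace ((z' - z) *\<^sub>R mat 1 :: real^'n^'n) = trace (0 :: real^'n^'n)"
    unfolding **[symmetric] using y by simp
  then show "z = z'"
    by (simp add: trace_def mat_def)
qed

text \<open>A congruence of bilinear forms induces a similarity of the associated operators. Invertibility
  of \<open>P\<close> follows from that of the two metrics by determinants.\<close>

lemma congruent_operators:
  fixes G G' T T' P :: "real^'n^'n::finite"
  assumes inv: "invertible G" "invertible G'"
    and G: "G' = transpose P ** G ** P" and T: "T' = transpose P ** T ** P"
  shows "invertible P" "P ** assoc_operator G' T' = assoc_operator G T ** P"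
proof -
  show P: "invertible P"
    using inv by (simp add: invertible_det_nz G det_mul)
  have "transpose P ** (G ** (P ** assoc_operator G' T')) = transpose P ** (G ** (assoc_operator G T ** P))"
    using matrix_inv_works[OF inv(1)] matrix_inv_works[OF inv(2)] G T
    by (metis (no_types, lifting) assoc_operator_def matrix_mul_assoc matrix_mul_lid)
  moreover have "invertible (transpose P)"
    using P by (simp add: invertible_det_nz)
  ultimately show "P ** assoc_operator G' T' = assoc_operator G T ** P"
    using inv(1) matrix_cancel_left by blast
qed

section \<open>The Ricci operator of the hypersurface\<close>

lemma chart_exists:
  assumes "semi_riemannian M" "p \<in> topspace (topo M)"
  obtains u where "u \<in> charts_at M p"
proof -
  have "(\<Union>u\<in>atlas M. fst u) = topspace (topo M)"
    using assms(1) by (simp add: semi_riemannian_def smooth_manifold_def smooth_atlas_def)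
  then have "\<exists>u\<in>atlas M. p \<in> fst u"
    using assms(2) by blast
  then show ?thesis
    using that by (auto simp: charts_at_def)
qed

text \<open>Invertibility of the transition matrix comes from the transformation law of the metric alone, so
  that nothing about the inverse coordinate change has to be shown.\<close>

lemma tensor_operator_change_of_chart:
  assumes M: "semi_riemannian M" and T: "tensor_field M T"
    and p: "p \<in> topspace (topo M)" and u: "u \<in> charts_at M p" and w: "w \<in> charts_at M p"
  obtains P where "invertible P"
    "metric M w p = transpose P ** metric M u p ** P" "T w p = transpose P ** T u p ** P"
    "P ** assoc_operator (metric M w p) (T w p) = assoc_operator (metric M u p) (T u p) ** P"
proof -
  let ?P = "transition w u p"
  have metric: "tensor_field M (metric M)" and inv: "invertible (metric M u p)" "invertible (metric M w p)"
    using M p u w by (auto simp: semi_riemannian_def smooth_tensor_field_def)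
  have law: "T w p = transpose ?P ** T u p ** ?P" if "tensor_field M T" for T
    using that[unfolded tensor_field_def, rule_format, OF p w u] .
  note G = law[OF metric] and T = law[OF T]
  show ?thesis
    by (rule that[OF _ G T]) (rule congruent_operators[OF inv G T])+
qed

text \<open>The operators in two charts are similar, which makes the description in \<open>tensor_trace\<close>
  unambiguous.\<close>

lemma tensor_trace_chart:
  assumes M: "semi_riemannian M" and T: "tensor_field M T"
    and p: "p \<in> topspace (topo M)" and u: "u \<in> charts_at M p"
  shows "tensor_trace M T p = trace (assoc_operator (metric M u p) (T u p))"
proof -
  have inv: "trace (assoc_operator (metric M w p) (T w p)) = trace (assoc_operator (metric M u p) (T u p))"
    if w: "w \<in> charts_at M p" for w
  proof -
    let ?a = "\<lambda>w. assoc_operator (metric M w p) (T w p)"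
    obtain P where P: "invertible P" and eq: "P ** ?a w = ?a u ** P"
      by (rule tensor_operator_change_of_chart[OF M T p u w])
    have "trace (?a w) = trace (matrix_inv P ** (P ** ?a w))"
      by (simp add: matrix_mul_assoc matrix_inv_works[OF P])
    also have "\<dots> = trace (?a u)"
      unfolding eq trace_mul_sym[of "matrix_inv P"]
      by (simp add: matrix_inv_works[OF P] flip: matrix_mul_assoc)
    finally show ?thesis .
  qed
  show ?thesis
    unfolding tensor_trace_def
  proof (rule the_equality)
    show "\<forall>w\<in>charts_at M p. trace (assoc_operator (metric M u p) (T u p)) =
        trace (assoc_operator (metric M w p) (T w p))"
      using inv[symmetric] by (rule ballI)
  qed (use u in blast)
qed

text \<open>A polynomial relation of the operator survives a similarity, so a linear relation found in one
  chart holds in all charts with the same coefficients. Its contrapositive gives, at the points of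
  \<open>\<U>\<^sub>H\<close>, linear independence within a single chart.\<close>

lemma lin_comb_at_of_chart:
  assumes M: "semi_riemannian M" and T: "tensor_field M T"
    and p: "p \<in> topspace (topo M)" and u: "u \<in> charts_at M p"
    and sym: "\<And>w. w \<in> charts_at M p \<Longrightarrow> transpose (T w p) = T w p"
    and eq: "a ** a = \<alpha> *\<^sub>R a + \<beta> *\<^sub>R mat 1" and a: "a = assoc_operator (metric M u p) (T u p)"
  shows "lin_comb_at M p (tensor_power M T 2) T (metric M)"
proof -
  have metric: "invertible (metric M w p)" "transpose (metric M w p) = metric M w p"
    if "w \<in> charts_at M p" for w
    using M p that by (auto simp: semi_riemannian_def)
  have "tensor_power M T 2 w p = \<alpha> *\<^sub>R T w p + \<beta> *\<^sub>R metric M w p" if w: "w \<in> charts_at M p" for w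
  proof -
    let ?b = "assoc_operator (metric M w p) (T w p)"
    note op = tensor_powers_operator[OF metric[OF w] sym[OF w]]
    obtain P where P: "invertible P" "P ** ?b = a ** P"
      unfolding a by (rule tensor_operator_change_of_chart[OF M T p u w])
    have "P ** (?b ** ?b) = (a ** a) ** P"
      unfolding matrix_mul_assoc P(2) unfolding P(2) matrix_mul_assoc[symmetric] ..
    also have "\<dots> = P ** (\<alpha> *\<^sub>R ?b + \<beta> *\<^sub>R mat 1)"
      by (simp add: eq matrix_bilinear P(2))
    finally have "?b ** ?b = \<alpha> *\<^sub>R ?b + \<beta> *\<^sub>R mat 1"
      using matrix_cancel_left P(1) by blast
    then show ?thesis
      by (simp add: tensor_power_def op(2) matrix_bilinear flip: op(1))
  qed
  then show ?thesis
    unfolding lin_comb_at_def by blast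
qed

text \<open>The Ricci operator is a quadratic polynomial in the shape operator \<open>a\<close>: the Gauss equation,
  contracted and rewritten with the metric factored out.\<close>

lemma ricci_hypersurface:
  fixes M :: "('a, 'n::finite) semi_riem" and N :: "('b, 'm::finite) semi_riem"
  assumes space: "space_of_constant_curvature N s c"
    and hyp: "hypersurface M N f" and \<xi>: "unit_normal M N f \<xi> \<epsilon>"
    and H: "second_fundamental_tensor M N f \<xi> H"
    and p: "p \<in> topspace (topo M)" and u: "u \<in> charts_at M p"
  defines "a \<equiv> assoc_operator (metric M u p) (H u p)"
  shows "transpose (H u p) = H u p"
    and "ricci M u p = metric M u p **
      ((- \<epsilon>) *\<^sub>R (a ** a) + (\<epsilon> * trace a) *\<^sub>R a + ((real CARD('n) - 1) * c) *\<^sub>R mat 1)"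
proof -
  have M: "semi_riemannian M" and N: "semi_riemannian N" and card: "CARD('m) = CARD('n) + 1"
    and f: "isometric_immersion M N f"
    using hyp by (auto simp: hypersurface_def)
  have fp: "f p \<in> topspace (topo N)"
    using f p by (auto simp: isometric_immersion_def smooth_map_def continuous_map_def)
  then obtain v where v: "v \<in> charts_at N (f p)"
    using chart_exists[OF N] by blast
  interpret immersed_patch M N f u v
    by unfold_locales (use M N f u v in \<open>auto simp: charts_at_def\<close>)
  have pW: "p \<in> W"
    using u v by (simp add: charts_at_def)
  have R: "riemann N v (f p) h i j k =
      c * (amb.g (f p) $ h $ k * amb.g (f p) $ i $ j - amb.g (f p) $ h $ j * amb.g (f p) $ i $ k)" for h i j k
    using bspec[OF conjunct2[OF conjunct2[OF space[unfolded space_of_constant_curvature_def]]] fp] v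
    by simp
  have \<xi>': "column i (differential f u v p) \<bullet> (amb.g (f p) *v \<xi> p v) = 0"
      "\<xi> p v \<bullet> (amb.g (f p) *v \<xi> p v) = \<epsilon>" "\<epsilon> = 1 \<or> \<epsilon> = -1" for i
    using bspec[OF bspec[OF conjunct2[OF \<xi>[unfolded unit_normal_def]] p] v] u
      conjunct1[OF \<xi>[unfolded unit_normal_def]] by simp_all
  have H': "H u p $ i $ j = hessian_along N f u v p i j \<bullet> (amb.g (f p) *v \<xi> p v)" for i j
    using bspec[OF bspec[OF bspec[OF conjunct2[OF H[unfolded second_fundamental_tensor_def]] p] u] v]
    by simp
  note Gauss = Gauss_equation_hypersurface[OF pW card R \<xi>' H']
  show sym: "transpose (H u p) = H u p"
    using Gauss(2) by (simp add: transpose_def vec_eq_iff)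
  have inv: "invertible (metric M u p)" and Gsym: "transpose (metric M u p) = metric M u p"
    using M p u by (auto simp: semi_riemannian_def)
  note op = tensor_powers_operator[OF inv Gsym sym, folded a_def]
  have square: "H u p ** matrix_inv (metric M u p) ** H u p = metric M u p ** (a ** a)"
  proof -
    have "H u p ** matrix_inv (metric M u p) ** H u p = H u p ** a"
      by (simp add: a_def assoc_operator_def matrix_mul_assoc)
    then show ?thesis
      using op(1) by (metis matrix_mul_assoc)
  qed
  have "ricci M u p $ i $ j = \<epsilon> * (trace a * H u p $ i $ j - (metric M u p ** (a ** a)) $ i $ j)
      + c * ((real CARD('n) - 1) * metric M u p $ i $ j)" for i j
    unfolding dom.ricci_eq_contraction[OF pW]
      contraction_Gauss[OF inv dom.metric_sym[OF pW] Gauss(2,1)] square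
    by (simp add: a_def assoc_operator_def)
  then have "ricci M u p = (- \<epsilon>) *\<^sub>R (metric M u p ** (a ** a)) + (\<epsilon> * trace a) *\<^sub>R H u p
      + ((real CARD('n) - 1) * c) *\<^sub>R metric M u p"
    by (simp add: vec_eq_iff algebra_simps)
  then show "ricci M u p = metric M u p **
      ((- \<epsilon>) *\<^sub>R (a ** a) + (\<epsilon> * trace a) *\<^sub>R a + ((real CARD('n) - 1) * c) *\<^sub>R mat 1)"
    by (simp only: matrix_bilinear matrix_mul_rid flip: op(1))
qed

theorem theorem5p1:
  fixes M :: "('a, 'n::finite) semi_riem" and N :: "('b, 'm::finite) semi_riem"
    and f :: "'a \<Rightarrow> 'b" and \<xi> :: "'a \<Rightarrow> ('b, 'm) chart \<Rightarrow> real^'m"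
    and H :: "('a, 'n) tensor2"
    and \<phi> \<psi> \<rho> \<tau> \<rho>1 \<rho>0 :: "'a \<Rightarrow> real" and c \<epsilon> n :: real and s :: nat
  assumes "n = real CARD('n)" and "n \<ge> 3"
    and "space_of_constant_curvature N s c"
    and "hypersurface M N f"
    and "unit_normal M N f \<xi> \<epsilon>"
    and "second_fundamental_tensor M N f \<xi> H"
    and "\<forall>p\<in>\<U>\<^sub>H M H. \<forall>u\<in>charts_at M p.
           tensor_power M H 3 u p =
             \<phi> p *\<^sub>R tensor_power M H 2 u p + \<psi> p *\<^sub>R H u p + \<rho> p *\<^sub>R metric M u p"
    and "\<forall>p\<in>\<U>\<^sub>H M H. \<tau> p =
           \<rho> p + (\<phi> p - tensor_trace M H p) *
             (\<psi> p + tensor_trace M H p * (\<phi> p - tensor_trace M H p))"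
    and "\<forall>p\<in>\<U>\<^sub>H M H. \<rho>1 p =
           2 * (n - 1) * c - \<epsilon> * (\<psi> p + (\<phi> p - tensor_trace M H p)^2)"
    and "\<forall>p\<in>\<U>\<^sub>H M H. \<rho>0 p =
           - ((n - 1)^2 * c^2) + \<epsilon> * (\<psi> p + (\<phi> p - tensor_trace M H p)^2) * (n - 1) * c
           + \<rho> p * (\<phi> p - 2 * tensor_trace M H p)"
    and "\<forall>p\<in>\<U>\<^sub>H M H. partially_einstein_at M p"
  shows "\<forall>p\<in>\<U>\<^sub>H M H.
           (\<forall>u\<in>charts_at M p.
              tensor_power M (ricci M) 2 u p = \<rho>1 p *\<^sub>R ricci M u p + \<rho>0 p *\<^sub>R metric M u p) \<and>
           \<tau> p = 0"
proof
  fix p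
  assume pU: "p \<in> \<U>\<^sub>H M H"
  then have p: "p \<in> topspace (topo M)"
    and nolin: "\<not> lin_comb_at M p (tensor_power M H 2) H (metric M)"
    by (auto simp: \<U>\<^sub>H_def)
  have M: "semi_riemannian M"
    using assms(4) by (simp add: hypersurface_def)
  have field: "tensor_field M H"
    using assms(6) by (simp add: second_fundamental_tensor_def)
  have \<epsilon>: "\<epsilon> = 1 \<or> \<epsilon> = -1"
    using assms(5) by (simp add: unit_normal_def)
  \<comment> \<open>The coefficients are common to all charts, so it is enough to identify them in one.\<close>
  obtain \<alpha> \<beta> where einstein:
    "\<And>u. u \<in> charts_at M p \<Longrightarrow>
      tensor_power M (ricci M) 2 u p = \<alpha> *\<^sub>R ricci M u p + \<beta> *\<^sub>R metric M u p"
    using assms(11) pU unfolding partially_einstein_at_def lin_comb_at_def by blast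
  obtain u where u: "u \<in> charts_at M p"
    using chart_exists[OF M p] by blast
  define G where "G = metric M u p"
  define a where "a = assoc_operator G (H u p)"
  define t where "t = tensor_trace M H p"
  define \<kappa> where "\<kappa> = (n - 1) * c"
  define b where "b = (- \<epsilon>) *\<^sub>R (a ** a) + (\<epsilon> * t) *\<^sub>R a + \<kappa> *\<^sub>R mat 1"
  have sym: "transpose (H w p) = H w p" if "w \<in> charts_at M p" for w
    using ricci_hypersurface(1)[OF assms(3-6) p that] .
  have inv: "invertible G" and Gsym: "transpose G = G"
    using M p u by (auto simp: semi_riemannian_def G_def)
  note H_op = tensor_powers_operator[OF inv Gsym sym[OF u], folded a_def]
  have t: "t = trace a"
    unfolding t_def a_def G_def by (rule tensor_trace_chart[OF M field p u])
  have ricci: "ricci M u p = G ** b"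
    using ricci_hypersurface(2)[OF assms(3-6) p u] assms(1)
    by (simp add: b_def t \<kappa>_def a_def G_def)
  have b: "assoc_operator G (ricci M u p) = b"
    by (simp add: assoc_operator_def ricci matrix_mul_assoc matrix_inv_works[OF inv])
  have "(G ** (a ** a)) $ i $ j = (G ** (a ** a)) $ j $ i" "H u p $ i $ j = H u p $ j $ i"
      "G $ i $ j = G $ j $ i" for i j
    using H_op(4) sym[OF u] Gsym by (simp_all add: transpose_def vec_eq_iff)
  then have ricci_sym: "transpose (ricci M u p) = ricci M u p"
    by (simp only: ricci b_def matrix_bilinear matrix_mul_rid flip: H_op(1))
      (simp add: transpose_def vec_eq_iff)
  have "G ** (a ** (a ** a)) = G ** (\<phi> p *\<^sub>R (a ** a) + \<psi> p *\<^sub>R a + \<rho> p *\<^sub>R mat 1)"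
    using assms(7)[rule_format, OF pU u]
    by (simp only: tensor_power_def matrix_bilinear matrix_mul_rid flip: G_def H_op)
  then have cubic: "a ** (a ** a) = \<phi> p *\<^sub>R (a ** a) + \<psi> p *\<^sub>R a + \<rho> p *\<^sub>R mat 1"
    by (rule matrix_cancel_left[OF inv])
  have "tensor_power M (ricci M) 2 u p = G ** (b ** b)"
    unfolding tensor_power_def
    using tensor_powers_operator(2)[OF inv Gsym ricci_sym] by (simp add: b flip: G_def)
  then have "G ** (b ** b) = G ** (\<alpha> *\<^sub>R b + \<beta> *\<^sub>R mat 1)"
    using einstein[OF u] by (simp only: matrix_bilinear matrix_mul_rid flip: ricci G_def)
  then have "b ** b = \<alpha> *\<^sub>R b + \<beta> *\<^sub>R mat 1"
    by (rule matrix_cancel_left[OF inv])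
  also have "\<dots> = (- \<alpha> * \<epsilon>) *\<^sub>R (a ** a) + (\<alpha> * \<epsilon> * t) *\<^sub>R a + (\<alpha> * \<kappa> + \<beta>) *\<^sub>R mat 1"
    by (simp add: b_def vec_eq_iff algebra_simps)
  \<comment> \<open>The same operator as a combination of \<open>a ** a\<close>, \<open>a\<close> and the identity in two ways: by the
  cubic relation, and by the partial Einstein condition.\<close>
  finally have expansions:
    "((- \<epsilon>)\<^sup>2 * ((\<phi> p)\<^sup>2 + \<psi> p) + 2 * (- \<epsilon>) * (\<epsilon> * t) * \<phi> p + (\<epsilon> * t)\<^sup>2 + 2 * (- \<epsilon>) * \<kappa>) *\<^sub>R (a ** a)
    + ((- \<epsilon>)\<^sup>2 * (\<phi> p * \<psi> p + \<rho> p) + 2 * (- \<epsilon>) * (\<epsilon> * t) * \<psi> p + 2 * (\<epsilon> * t) * \<kappa>) *\<^sub>R a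
    + ((- \<epsilon>)\<^sup>2 * \<phi> p * \<rho> p + 2 * (- \<epsilon>) * (\<epsilon> * t) * \<rho> p + \<kappa>\<^sup>2) *\<^sub>R mat 1
    = (- \<alpha> * \<epsilon>) *\<^sub>R (a ** a) + (\<alpha> * \<epsilon> * t) *\<^sub>R a + (\<alpha> * \<kappa> + \<beta>) *\<^sub>R mat 1"
    unfolding square_of_quadratic_operator[OF cubic b_def] .
  have "\<nexists>\<alpha> \<beta>. a ** a = \<alpha> *\<^sub>R a + \<beta> *\<^sub>R mat 1"
    using lin_comb_at_of_chart[OF M field p u sym] nolin unfolding a_def G_def by blast
  note coeffs = quadratic_operator_independent[OF this expansions]
  \<comment> \<open>The coefficients of \<open>a ** a\<close> determine \<open>\<alpha>\<close>, those of the identity then determine \<open>\<beta>\<close>, and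
  those of \<open>a\<close> leave the condition \<open>\<tau> = 0\<close>.\<close>
  have \<alpha>\<epsilon>: "\<alpha> * \<epsilon> = 2 * \<epsilon> * \<kappa> - (\<psi> p + (\<phi> p - t)\<^sup>2)"
    using coeffs(1) \<epsilon> by (auto simp: power2_eq_square algebra_simps)
  have "\<alpha> = \<alpha> * \<epsilon> * \<epsilon>"
    using \<epsilon> by auto
  also have "\<dots> = 2 * \<kappa> - \<epsilon> * (\<psi> p + (\<phi> p - t)\<^sup>2)"
    unfolding \<alpha>\<epsilon> using \<epsilon> by (auto simp: algebra_simps)
  finally have \<alpha>: "\<alpha> = 2 * \<kappa> - \<epsilon> * (\<psi> p + (\<phi> p - t)\<^sup>2)" .
  have \<beta>: "\<beta> = - \<kappa>\<^sup>2 + \<epsilon> * (\<psi> p + (\<phi> p - t)\<^sup>2) * \<kappa> + \<rho> p * (\<phi> p - 2 * t)"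
    using coeffs(3) \<epsilon> unfolding \<alpha> by (auto simp: power2_eq_square algebra_simps)
  have \<tau>: "\<rho> p + (\<phi> p - t) * (\<psi> p + t * (\<phi> p - t)) = 0"
    using coeffs(2) \<epsilon> unfolding \<alpha>\<epsilon> by (auto simp: power2_eq_square algebra_simps)
  have "\<rho>1 p = \<alpha>"
    using assms(9) pU by (simp add: \<alpha> \<kappa>_def flip: t_def)
  moreover have "\<rho>0 p = \<beta>"
    using assms(10) pU by (simp add: \<beta> \<kappa>_def power_mult_distrib flip: t_def)
  moreover have "\<tau> p = 0"
    using assms(8) pU \<tau> by (simp flip: t_def)
  ultimately show "(\<forall>u\<in>charts_at M p.
      tensor_power M (ricci M) 2 u p = \<rho>1 p *\<^sub>R ricci M u p + \<rho>0 p *\<^sub>R metric M u p) \<and> \<tau> p = 0"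
    using einstein by blast
qed

end
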